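(* Let $G$ be a doubly-connected graph of order $n\ge 5$ and let $\overline G$ be its complement. Then $4\le\eta(G)+\eta(\overline G)\le 2n-5$. Moreover, up to isomorphism: (i) $\eta(G)+\eta(\overline G)=4$ if and only if $G\in\{P_5,C_5,B,H,E,F\}$; (ii) $\eta(G)+\eta(\overline G)=2n-5$ if and only if $G$ is one of $K_2(r,s)$, $\overline K_2(r,s)$ (for some integers $r,s\ge 1$), $K^s_{1,r}$, $\overline K^s_{1,r}$ (for some integers $r,s$ with $2\le s\le r-1$).
   Context: Graphs are finite, simple and undirected. A graph $G$ is doubly-connected if both $G$ and its complement $\overline G$ are connected. For a connected graph $G=(V,E)$ with distance $d$, a set $D=\{x_1,\dots,x_k\}\subseteq V$ is dominating if every vertex of $V\setminus D$ has a neighbor in $D$; it is locating if the vectors $(d(v,x_1),\dots,d(v,x_k))$, $v\in V$, are pairwise distinct. A metric-locating-dominating set is a set that is both dominating and locating, and $\eta(G)$ is the minimum cardinality of such a set. $P_5$ and $C_5$ are the path and cycle on 5 vertices. $B$ is the bull graph: a triangle with one pendant vertex attached to each of two distinct vertices of the triangle. $H=\overline{P_5}$ is the house graph (a 5-cycle with one chord). $E$ and $F=\overline E$ are the following complementary pair of graphs on 6 vertices: one of them is the house graph with an additional pendant vertex attached to a degree-2 vertex of the house not lying on its triangle, i.e. the graph with vertices $1,\dots,6$ and edges $12,23,34,41,25,35,16$... where $1,2,3,4$ is the 4-cycle, $5$ is adjacent exactly to $2,3$, and $6$ is adjacent exactly to $1$; the other is the complement of this graph. For positive integers $r,s$, $K_2(r,s)$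 is the double star obtained by joining by an edge the central vertices of the stars $K_{1,r}$ and $K_{1,s}$ (so it has $r+s+2$ vertices). For $2\le s\le r-1$, $K^s_{1,r}$ is the graph obtained from the star $K_{1,r}$ by adding a new vertex adjacent to exactly $s$ leaves of the star (so it has $r+2$ vertices). $\overline K_2(r,s)$ and $\overline K^s_{1,r}$ denote the complements of $K_2(r,s)$ and $K^s_{1,r}$. *)

theory Defs
  imports Main
begin

record 'a ugraph =
  verts :: "'a set"
  adj :: "'a \<Rightarrow> 'a \<Rightarrow> bool"

definition simple_graph :: "'a ugraph \<Rightarrow> bool" where
  "simple_graph G \<longleftrightarrow>
     finite (verts G) \<and>
     (\<forall>u v. adj G u v \<longrightarrow> u \<in> verts G \<and> v \<in> verts G \<and> u \<noteq> v \<and> adj G v u)"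

definition graph_compl :: "'a ugraph \<Rightarrow> 'a ugraph" where
  "graph_compl G =
     \<lparr>verts = verts G,
      adj = (\<lambda>u v. u \<in> verts G \<and> v \<in> verts G \<and> u \<noteq> v \<and> \<not> adj G u v)\<rparr>"

definition graph_iso :: "'a ugraph \<Rightarrow> 'b ugraph \<Rightarrow> bool"  (infix "\<simeq>" 50) where
  "G \<simeq> H \<longleftrightarrow>
     (\<exists>f. bij_betw f (verts G) (verts H) \<and>
          (\<forall>u\<in>verts G. \<forall>v\<in>verts G. adj G u v \<longleftrightarrow> adj H (f u) (f v)))"

definition graph_connected :: "'a ugraph \<Rightarrow> bool" where
  "graph_connected G \<longleftrightarrow>
     verts G \<noteq> {} \<and> (\<forall>u\<in>verts G. \<forall>v\<in>verts G. (adj G)\<^sup>*\<^sup>* u v)"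

definition doubly_connected :: "'a ugraph \<Rightarrow> bool" where
  "doubly_connected G \<longleftrightarrow> graph_connected G \<and> graph_connected (graph_compl G)"

text \<open>The relational power \<open>adj G ^^ k\<close> holds between the endpoints of the walks with k edges, and
  a walk of minimum length is a path. For vertices that no walk joins, the value is unspecified.\<close>

definition graph_dist :: "'a ugraph \<Rightarrow> 'a \<Rightarrow> 'a \<Rightarrow> nat" where
  "graph_dist G u v = (LEAST k. (adj G ^^ k) u v)"

definition dominating :: "'a ugraph \<Rightarrow> 'a set \<Rightarrow> bool" where
  "dominating G D \<longleftrightarrow>
     D \<subseteq> verts G \<and> (\<forall>v \<in> verts G - D. \<exists>x\<in>D. adj G v x)"

definition locating :: "'a ugraph \<Rightarrow> 'a set \<Rightarrow> bool" where
  "locating G D \<longleftrightarrow>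
     D \<subseteq> verts G \<and>
     (\<forall>u\<in>verts G. \<forall>v\<in>verts G. u \<noteq> v \<longrightarrow> (\<exists>x\<in>D. graph_dist G u x \<noteq> graph_dist G v x))"

definition metric_locating_dominating :: "'a ugraph \<Rightarrow> 'a set \<Rightarrow> bool" where
  "metric_locating_dominating G D \<longleftrightarrow> dominating G D \<and> locating G D"

definition eta :: "'a ugraph \<Rightarrow> nat" where
  "eta G = (LEAST k. \<exists>D. metric_locating_dominating G D \<and> card D = k)"

definition from_edges :: "'a set \<Rightarrow> ('a \<times> 'a) set \<Rightarrow> 'a ugraph" where
  "from_edges V S =
     \<lparr>verts = V, adj = (\<lambda>u v. (u, v) \<in> S \<or> (v, u) \<in> S)\<rparr>"

definition path_5 :: "nat ugraph" where
  "path_5 = from_edges {1..5} {(1,2), (2,3), (3,4), (4,5)}"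

definition cycle_5 :: "nat ugraph" where
  "cycle_5 = from_edges {1..5} {(1,2), (2,3), (3,4), (4,5), (5,1)}"

definition bull :: "nat ugraph" where
  "bull = from_edges {1..5} {(1,2), (2,3), (3,1), (1,4), (2,5)}"

definition house :: "nat ugraph" where
  "house = graph_compl path_5"

text \<open>The vertices 1 to 5 induce a house, with 4-cycle 1, 2, 3, 4 and roof 5; the vertex 6 is
  pendant at 1, a vertex of degree 2 in the house that is not on its triangle.\<close>

definition graph_E :: "nat ugraph" where
  "graph_E = from_edges {1..6} {(1,2), (2,3), (3,4), (4,1), (2,5), (3,5), (1,6)}"

definition graph_F :: "nat ugraph" where
  "graph_F = graph_compl graph_E"

text \<open>The double star \<open>K\<^sub>2(r,s)\<close>: the centres are 0 (with leaves 2 to r+1) and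
  1 (with leaves r+2 to r+s+1).\<close>

definition double_star :: "nat \<Rightarrow> nat \<Rightarrow> nat ugraph" where
  "double_star r s =
     from_edges {..<r + s + 2}
       ({(0, 1)} \<union> {0} \<times> {2..<r + 2} \<union> {1} \<times> {r + 2..<r + s + 2})"

text \<open>The graph obtained from the star with centre 0 and leaves 1 to r by adding the vertex r+1,
  adjacent to the leaves 1 to s.\<close>

definition extended_star :: "nat \<Rightarrow> nat \<Rightarrow> nat ugraph" where
  "extended_star r s =
     from_edges {..<r + 2} ({0} \<times> {1..r} \<union> {r + 1} \<times> {1..s})"

end

theory Submission
  imports Defs
begin

text \<open>
  A minimum metric-locating-dominating set of size at least \<open>n - 2\<close> means that no three vertices can be
  left out. Leaving out three suitable vertices shows that an induced path on four vertices, which a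
  doubly-connected graph contains, cannot have ends with a common neighbour. So its ends are at
  distance 3, and then every other vertex must be a near-twin of one of the ends, which forces a
  double star or an extended star. Those graphs have \<open>\<eta> = n - 2\<close>, and their complements \<open>\<eta> = n - 3\<close>.

  The sum is 4 only if both graphs have a metric-locating-dominating pair. From order 6 on, a pair can
  tell the vertices apart only if some distance is at least 3, in both graphs; hence all distances are
  at most 3 in both, the order is 6, and four adjacencies remain undetermined.
\<close>

section \<open>Distances and metric-locating-dominating sets\<close>

text \<open>Distances enter almost only through adjacency: 0 is equality, 1 an edge, 2 a common
  neighbour without an edge, and anything larger is treated as "not 2". Upper bounds on
  \<open>eta\<close> name vertices that can be left out; lower bounds count twins, since a class of
  twins can lose only one member. The bound 2n-5 is odd because a graph of value n-2 never has a
  complement of the same value: its complement has value n-3. If neither graph is extremal, both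
  values are at most n-3 and the sum is at most 2n-6. For sum 4 the link between the two graphs is
  that vertices at distance at least 3 in one graph form an edge of the other, and that this edge
  dominates the other graph, which then has diameter at most 3. The possible distance vectors to a
  pair are then (1,1), (1,2), (2,1), (1,3), (3,1), so the order is at most 7. Order 7 needs its own
  argument, since counting alone does not exclude it.\<close>

definition common_neighbour :: "'a ugraph \<Rightarrow> 'a \<Rightarrow> 'a \<Rightarrow> bool" where
  "common_neighbour G u v \<longleftrightarrow> (\<exists>x. adj G u x \<and> adj G x v)"

definition induced_P4 :: "'a ugraph \<Rightarrow> 'a \<Rightarrow> 'a \<Rightarrow> 'a \<Rightarrow> 'a \<Rightarrow> bool" where
  "induced_P4 G a b c d \<longleftrightarrow>
     adj G a b \<and> adj G b c \<and> adj G c d \<and>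
     \<not> adj G a c \<and> \<not> adj G b d \<and> \<not> adj G a d \<and> a \<noteq> c \<and> b \<noteq> d \<and> a \<noteq> d"

lemma verts_graph_compl [simp]: "verts (graph_compl G) = verts G"
  by (simp add: graph_compl_def)

lemma adj_graph_compl [simp]:
  "adj (graph_compl G) u v \<longleftrightarrow> u \<in> verts G \<and> v \<in> verts G \<and> u \<noteq> v \<and> \<not> adj G u v"
  by (simp add: graph_compl_def)

lemma simple_graph_compl: "simple_graph G \<Longrightarrow> simple_graph (graph_compl G)"
  by (auto simp: simple_graph_def)

lemma graph_compl_compl: "simple_graph G \<Longrightarrow> graph_compl (graph_compl G) = G"
  by (cases G) (fastforce simp: graph_compl_def simple_graph_def fun_eq_iff)

lemma doubly_connected_compl:
  "simple_graph G \<Longrightarrow> doubly_connected (graph_compl G) \<longleftrightarrow> doubly_connected G"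
  by (auto simp: doubly_connected_def graph_compl_compl)

locale connected_graph =
  fixes G :: "'a ugraph"
  assumes simple: "simple_graph G" and connected: "graph_connected G"
begin

lemma finite_verts [simp]: "finite (verts G)"
  using simple by (simp add: simple_graph_def)

lemma adj_verts: "adj G u v \<Longrightarrow> u \<in> verts G \<and> v \<in> verts G"
  using simple by (simp add: simple_graph_def)

lemma adj_irrefl [simp]: "\<not> adj G u u"
  using simple by (auto simp: simple_graph_def)

lemma adj_commute: "adj G u v \<longleftrightarrow> adj G v u"
  using simple by (auto simp: simple_graph_def)

lemma common_neighbour_commute: "common_neighbour G u v \<longleftrightarrow> common_neighbour G v u"
  unfolding common_neighbour_def by (meson adj_commute)

lemma relpowp_2: "(adj G ^^ 2) u v \<longleftrightarrow> common_neighbour G u v"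
  by (auto simp: numeral_2_eq_2 common_neighbour_def relcompp_apply)

lemma relpowp_graph_dist:
  assumes "u \<in> verts G" "v \<in> verts G"
  shows "(adj G ^^ graph_dist G u v) u v"
proof -
  have "(adj G)\<^sup>*\<^sup>* u v" using connected assms by (simp add: graph_connected_def)
  then show ?thesis unfolding graph_dist_def by (metis LeastI rtranclp_imp_relpowp)
qed

lemma graph_dist_le: "(adj G ^^ k) u v \<Longrightarrow> graph_dist G u v \<le> k"
  unfolding graph_dist_def by (rule Least_le)

lemma graph_dist_eq_0:
  "u \<in> verts G \<Longrightarrow> v \<in> verts G \<Longrightarrow> graph_dist G u v = 0 \<longleftrightarrow> u = v"
  using relpowp_graph_dist[of u v] graph_dist_le[of 0 u v] by auto

lemma graph_dist_eq_1:
  assumes "u \<in> verts G" "v \<in> verts G"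
  shows "graph_dist G u v = 1 \<longleftrightarrow> adj G u v"
proof
  assume "adj G u v"
  then have "graph_dist G u v \<le> 1" "u \<noteq> v" using graph_dist_le[of 1 u v] by auto
  then show "graph_dist G u v = 1" using graph_dist_eq_0[OF assms] by linarith
qed (use relpowp_graph_dist[OF assms] in auto)

lemma graph_dist_eq_2:
  assumes "u \<in> verts G" "v \<in> verts G"
  shows "graph_dist G u v = 2 \<longleftrightarrow> u \<noteq> v \<and> \<not> adj G u v \<and> common_neighbour G u v"
proof
  assume "u \<noteq> v \<and> \<not> adj G u v \<and> common_neighbour G u v"
  then show "graph_dist G u v = 2"
    using graph_dist_eq_0[OF assms] graph_dist_eq_1[OF assms] graph_dist_le[of 2 u v]
    unfolding relpowp_2 by linarith
qed (use relpowp_graph_dist[OF assms] relpowp_2[of u v] graph_dist_eq_0[OF assms]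
  graph_dist_eq_1[OF assms] in auto)

text \<open>A member of \<open>D\<close> is the only vertex at distance 0 from itself, so only pairs
  outside \<open>D\<close> have to be separated.\<close>

lemma metric_locating_dominatingI:
  assumes "D \<subseteq> verts G"
    and "\<And>v. v \<in> verts G - D \<Longrightarrow> \<exists>x\<in>D. adj G v x"
    and "\<And>u v. u \<in> verts G - D \<Longrightarrow> v \<in> verts G - D \<Longrightarrow> u \<noteq> v \<Longrightarrow>
      \<exists>x\<in>D. graph_dist G u x \<noteq> graph_dist G v x"
  shows "metric_locating_dominating G D"
proof -
  have "\<exists>x\<in>D. graph_dist G u x \<noteq> graph_dist G v x"
    if "u \<in> verts G" "v \<in> verts G" "u \<noteq> v" for u v
    using that assms(3)[of u v] graph_dist_eq_0 by (cases "u \<in> D \<or> v \<in> D") (metis, blast)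
  then show ?thesis
    using assms(1,2) by (auto simp: metric_locating_dominating_def dominating_def locating_def)
qed

text \<open>Guarantees that the \<open>LEAST\<close> in \<open>eta\<close> is attained.\<close>

lemma metric_locating_dominating_verts: "metric_locating_dominating G (verts G)"
  by (rule metric_locating_dominatingI) auto

lemma eta_attained: "\<exists>D. metric_locating_dominating G D \<and> card D = eta G"
  unfolding eta_def
  by (rule LeastI_ex[of "\<lambda>k. \<exists>D. metric_locating_dominating G D \<and> card D = k"])
    (use metric_locating_dominating_verts in blast)

lemma eta_le: "metric_locating_dominating G D \<Longrightarrow> eta G \<le> card D"
  unfolding eta_def by (auto intro: Least_le)

lemma mld_subset: "metric_locating_dominating G D \<Longrightarrow> D \<subseteq> verts G"
  by (simp add: metric_locating_dominating_def dominating_def)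

lemma mld_dominates:
  "metric_locating_dominating G D \<Longrightarrow> v \<in> verts G \<Longrightarrow> v \<notin> D \<Longrightarrow> \<exists>x\<in>D. adj G v x"
  by (simp add: metric_locating_dominating_def dominating_def)

lemma mld_locates:
  "metric_locating_dominating G D \<Longrightarrow> u \<in> verts G \<Longrightarrow> v \<in> verts G \<Longrightarrow> u \<noteq> v \<Longrightarrow>
    \<exists>x\<in>D. graph_dist G u x \<noteq> graph_dist G v x"
  by (simp add: metric_locating_dominating_def locating_def)

text \<open>Vertices with the same neighbours are at the same distance from every other vertex, since
  every walk leaving the one can be rerouted through the other.\<close>

lemma graph_dist_twins:
  assumes "u \<in> verts G" "v \<in> verts G" "x \<in> verts G" "x \<noteq> u" "x \<noteq> v"
    and twins: "\<And>y. y \<noteq> u \<Longrightarrow> y \<noteq> v \<Longrightarrow> adj G u y \<longleftrightarrow> adj G v y"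
  shows "graph_dist G u x = graph_dist G v x"
proof -
  have le: "graph_dist G b x \<le> graph_dist G a x"
    if "{a, b} = {u, v}" for a b
  proof -
    have tw: "adj G a y \<longleftrightarrow> adj G b y" if "y \<noteq> a" "y \<noteq> b" for y
      using twins[of y] that \<open>{a, b} = {u, v}\<close> by (auto simp: doubleton_eq_iff)
    have V: "a \<in> verts G" "b \<in> verts G" "x \<noteq> a" "x \<noteq> b"
      using that assms by (auto simp: doubleton_eq_iff)
    obtain k where k: "graph_dist G a x = Suc k"
      using graph_dist_eq_0[of a x] V assms(3) by (metis not0_implies_Suc)
    then obtain y where y: "adj G a y" "(adj G ^^ k) y x"
      using relpowp_graph_dist[of a x] V assms(3) by (metis relpowp_Suc_D2)
    show ?thesis
    proof (cases "y = b")
      case True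
      then show ?thesis using graph_dist_le[OF y(2)] k by simp
    next
      case False
      then have "adj G b y" using tw[of y] y(1) by (metis adj_irrefl)
      then show ?thesis using graph_dist_le[of "Suc k" b x] k y(2) relpowp_Suc_I2 by metis
    qed
  qed
  show ?thesis using le[of u v] le[of v u] by (simp add: insert_commute)
qed

text \<open>Two twins outside \<open>D\<close> would be at equal distances from all of
  \<open>D\<close>. The condition on \<open>y\<close> exempts the two twins themselves, so it covers
  adjacent as well as non-adjacent twins.\<close>

lemma mld_omits_one_twin:
  assumes "metric_locating_dominating G D"
    and "T \<subseteq> verts G"
    and "\<And>u v y. u \<in> T \<Longrightarrow> v \<in> T \<Longrightarrow> y \<noteq> u \<Longrightarrow> y \<noteq> v \<Longrightarrow> adj G u y \<longleftrightarrow> adj G v y"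
    and "u \<in> T - D" "v \<in> T - D"
  shows "u = v"
proof (rule ccontr)
  assume "u \<noteq> v"
  then obtain x where "x \<in> D" "graph_dist G u x \<noteq> graph_dist G v x"
    using mld_locates[OF assms(1), of u v] assms by auto
  then show False
    using graph_dist_twins[of u v x] assms mld_subset[OF assms(1)] by blast
qed

lemma eta_le_omit:
  assumes "S \<subseteq> verts G"
    and "\<And>u. u \<in> S \<Longrightarrow> \<exists>x. x \<notin> S \<and> adj G u x"
    and "\<And>u v. u \<in> S \<Longrightarrow> v \<in> S \<Longrightarrow> u \<noteq> v \<Longrightarrow>
      \<exists>x\<in>verts G - S. graph_dist G u x \<noteq> graph_dist G v x"
  shows "eta G + card S \<le> card (verts G)"
proof -
  have "metric_locating_dominating G (verts G - S)"
    by (rule metric_locating_dominatingI) (use assms adj_verts in \<open>blast+\<close>)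
  from eta_le[OF this] show ?thesis
    using card_Diff_subset[of S "verts G"] assms(1) finite_subset[OF assms(1)]
      card_mono[OF finite_verts assms(1)] by auto
qed

lemma eta_ge_omit:
  assumes "\<And>D. metric_locating_dominating G D \<Longrightarrow> card (verts G - D) \<le> m"
  shows "card (verts G) \<le> eta G + m"
proof -
  obtain D where D: "metric_locating_dominating G D" "card D = eta G"
    using eta_attained by blast
  then show ?thesis
    using assms[OF D(1)] card_Diff_subset[of D "verts G"] mld_subset[OF D(1)]
      finite_subset[OF mld_subset[OF D(1)] finite_verts] by simp
qed

lemma separated_by_adj:
  assumes "u \<in> verts G" "v \<in> verts G" "x \<in> verts G"
  shows "adj G u x \<noteq> adj G v x \<Longrightarrow> graph_dist G u x \<noteq> graph_dist G v x"
  using graph_dist_eq_1 assms by metis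

text \<open>\<open>S\<close> is the set of vertices left out; a separating vertex must survive
  outside it.\<close>

definition separates :: "'a \<Rightarrow> 'a set \<Rightarrow> 'a \<Rightarrow> 'a \<Rightarrow> bool" where
  "separates x S u v \<longleftrightarrow> x \<in> verts G \<and> x \<notin> S \<and> graph_dist G u x \<noteq> graph_dist G v x"

lemma separatesI:
  "adj G u x \<noteq> adj G v x \<Longrightarrow> u \<in> verts G \<Longrightarrow> v \<in> verts G \<Longrightarrow> x \<notin> S \<Longrightarrow> separates x S u v"
  unfolding separates_def using separated_by_adj adj_verts by blast

lemma eta_le_pair:
  assumes "u \<noteq> v" "adj G u x" "x \<notin> {u, v}" "adj G v y" "y \<notin> {u, v}" "separates z {u, v} u v"
  shows "eta G + 2 \<le> card (verts G)"
proof -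
  have "eta G + card {u, v} \<le> card (verts G)"
  proof (rule eta_le_omit)
    show "{u, v} \<subseteq> verts G" using assms(2,4) adj_verts by auto
    show "\<exists>x. x \<notin> {u, v} \<and> adj G s x" if "s \<in> {u, v}" for s
      using that assms(2-5) by blast
    show "\<exists>x\<in>verts G - {u, v}. graph_dist G s x \<noteq> graph_dist G t x"
      if "s \<in> {u, v}" "t \<in> {u, v}" "s \<noteq> t" for s t
      using that assms(6) unfolding separates_def by (metis Diff_iff insertE singletonD)
  qed
  then show ?thesis using assms(1) by simp
qed

text \<open>The instantiations below list the omitted vertices \<open>u\<close>, \<open>v\<close>,
  \<open>w\<close>, then a remaining neighbour \<open>x\<close>, \<open>y\<close>, \<open>z\<close>
  of each, then the vertices \<open>a\<close>, \<open>b\<close>, \<open>c\<close> that separate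
  \<open>u\<close> from \<open>v\<close>, \<open>u\<close> from \<open>w\<close> and
  \<open>v\<close> from \<open>w\<close>.\<close>

lemma eta_le_triple:
  assumes "u \<noteq> v" "u \<noteq> w" "v \<noteq> w"
    and "adj G u x" "x \<notin> {u, v, w}" "adj G v y" "y \<notin> {u, v, w}" "adj G w z" "z \<notin> {u, v, w}"
    and "separates a {u, v, w} u v" "separates b {u, v, w} u w" "separates c {u, v, w} v w"
  shows "eta G + 3 \<le> card (verts G)"
proof -
  have "eta G + card {u, v, w} \<le> card (verts G)"
  proof (rule eta_le_omit)
    show "{u, v, w} \<subseteq> verts G" using assms(4,6,8) adj_verts by auto
    show "\<exists>x. x \<notin> {u, v, w} \<and> adj G s x" if "s \<in> {u, v, w}" for s
      using that assms(4-9) by blast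
    show "\<exists>x\<in>verts G - {u, v, w}. graph_dist G s x \<noteq> graph_dist G t x"
      if "s \<in> {u, v, w}" "t \<in> {u, v, w}" "s \<noteq> t" for s t
      using that assms(10-12) unfolding separates_def by (metis Diff_iff insertE singletonD)
  qed
  then show ?thesis using assms(1-3) by simp
qed

end

section \<open>Graphs in which no three vertices can be left out\<close>

text \<open>A description free of numbering: \<open>A\<close> and \<open>B\<close> are the leaves at
  the centres \<open>c\<close> and \<open>d\<close>. It can be recognised inside an arbitrary graph
  and transported along isomorphisms.\<close>

definition double_star_shape :: "'a ugraph \<Rightarrow> 'a \<Rightarrow> 'a \<Rightarrow> 'a set \<Rightarrow> 'a set \<Rightarrow> bool" where
  "double_star_shape G c d A B \<longleftrightarrow>
     c \<noteq> d \<and> c \<notin> A \<union> B \<and> d \<notin> A \<union> B \<and> A \<inter> B = {} \<and> A \<noteq> {} \<and> B \<noteq> {} \<and>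
     verts G = {c, d} \<union> A \<union> B \<and>
     (\<forall>u v. adj G u v \<longleftrightarrow>
        u = c \<and> v = d \<or> u = d \<and> v = c \<or> u = c \<and> v \<in> A \<or> v = c \<and> u \<in> A \<or>
        u = d \<and> v \<in> B \<or> v = d \<and> u \<in> B)"

text \<open>The star has centre \<open>c\<close>; \<open>M\<close> consists of the leaves joined to
  the extra vertex \<open>t\<close>, \<open>P\<close> of the other leaves. With a single vertex in
  \<open>M\<close> the graph would be a double star.\<close>

definition extended_star_shape :: "'a ugraph \<Rightarrow> 'a \<Rightarrow> 'a \<Rightarrow> 'a set \<Rightarrow> 'a set \<Rightarrow> bool" where
  "extended_star_shape G c t M P \<longleftrightarrow>
     c \<noteq> t \<and> c \<notin> M \<union> P \<and> t \<notin> M \<union> P \<and> M \<inter> P = {} \<and> 2 \<le> card M \<and> P \<noteq> {} \<and>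
     verts G = {c, t} \<union> M \<union> P \<and>
     (\<forall>u v. adj G u v \<longleftrightarrow>
        u = c \<and> v \<in> M \<union> P \<or> v = c \<and> u \<in> M \<union> P \<or> u = t \<and> v \<in> M \<or> v = t \<and> u \<in> M)"

text \<open>The diameter 2 case of the theorem that a graph without induced four-vertex paths is
  disconnected or has a disconnected complement. For a fixed \<open>v\<close>, choose a
  non-neighbour \<open>m\<close> with the fewest common neighbours \<open>X m\<close>. Without an
  induced path, \<open>X m\<close> is completely joined to its outside, so no edge of the complement
  leaves it.\<close>

lemma induced_P4_exists_if_common_neighbours:
  assumes "simple_graph G" "graph_connected (graph_compl G)" "2 \<le> card (verts G)"
    and cn: "\<And>u v. u \<in> verts G \<Longrightarrow> v \<in> verts G \<Longrightarrow> u \<noteq> v \<Longrightarrow> \<not> adj G u v \<Longrightarrow>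
      common_neighbour G u v"
  shows "\<exists>a b c d. induced_P4 G a b c d"
proof (rule ccontr)
  assume no: "\<nexists>a b c d. induced_P4 G a b c d"
  interpret C: connected_graph "graph_compl G"
    using assms(1,2) by unfold_locales (simp_all add: simple_graph_compl)
  have sym: "adj G u v \<longleftrightarrow> adj G v u" and irr: "\<not> adj G u u"
    and vs: "adj G u v \<Longrightarrow> u \<in> verts G \<and> v \<in> verts G" for u v
    using assms(1) by (auto simp: simple_graph_def)
  have fin: "finite (verts G)" using assms(1) by (simp add: simple_graph_def)
  have P4: False if "adj G a b" "adj G b c" "adj G c d" "\<not> adj G a c" "\<not> adj G b d"
    "\<not> adj G a d" "a \<noteq> c" "b \<noteq> d" "a \<noteq> d" for a b c d
    using no that unfolding induced_P4_def by blast
  obtain v w where v: "v \<in> verts G" and w: "w \<in> verts G" "w \<noteq> v"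
    using assms(3) by (metis card_2_iff' obtain_subset_with_card_n subsetD)
  have "\<exists>m. m \<in> verts G \<and> m \<noteq> v \<and> \<not> adj G v m"
  proof -
    have "(adj (graph_compl G))\<^sup>*\<^sup>* v w" using C.connected v w by (simp add: graph_connected_def)
    then obtain m where "adj (graph_compl G) v m" using w(2) by (metis converse_rtranclpE)
    then show ?thesis by auto
  qed
  define M where "M = {m \<in> verts G. m \<noteq> v \<and> \<not> adj G v m}"
  define X where "X m = {x. adj G v x \<and> adj G m x}" for m
  have "M \<noteq> {}" using \<open>\<exists>m. _\<close> by (auto simp: M_def)
  then obtain m where m: "m \<in> M" and min: "\<And>m'. m' \<in> M \<Longrightarrow> card (X m) \<le> card (X m')"
    using ex_has_least_nat[of "\<lambda>m. m \<in> M" _ "\<lambda>m. card (X m)"] by blast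
  have finX: "finite (X m')" for m'
    by (rule finite_subset[OF _ fin]) (use vs in \<open>auto simp: X_def\<close>)
  have "X m \<noteq> {}"
    using cn[of v m] m v sym unfolding X_def M_def common_neighbour_def by blast
  have sub: "X m \<subseteq> X m'" if m': "m' \<in> M" for m'
  proof
    fix x assume x: "x \<in> X m"
    show "x \<in> X m'"
    proof (rule ccontr)
      assume nx: "x \<notin> X m'"
      \<comment> \<open>As \<open>x\<close> is missing from \<open>X m'\<close>, an inclusion in
        \<open>X m\<close> would be proper and contradict minimality. With the resulting
        \<open>y\<close>, one of the paths \<open>v x m m'\<close>, \<open>m x y m'\<close>,
        \<open>x v y m'\<close> is induced, depending on whether \<open>m m'\<close> and
        \<open>x y\<close> are edges.\<close>
      have "\<not> X m' \<subseteq> X m"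
        using psubset_card_mono[OF finX[of m], of "X m'"] min[OF m'] x nx by (metis leD psubsetI)
      then obtain y where y: "y \<in> X m'" "y \<notin> X m" by blast
      have 1: "\<not> adj G m m'" using P4[of v x m m'] x nx m m' irr sym by (auto simp: X_def M_def)
      have 2: "\<not> adj G x y"
        using P4[of m x y m'] x y nx 1 sym by (auto simp: X_def)
      show False
        using P4[of x v y m'] x y nx m m' 2 sym by (auto simp: X_def M_def)
    qed
  qed
  have complete: "adj G x y" if x: "x \<in> X m" and y: "y \<in> verts G" "y \<notin> X m" for x y
  proof (cases "y = v \<or> y \<in> M")
    case True
    then show ?thesis using sub[of y] x sym by (auto simp: X_def)
  next
    case False
    then have "adj G v y" "\<not> adj G m y" using y by (auto simp: X_def M_def)
    then show ?thesis using P4[of y v x m] x m sym y by (auto simp: X_def M_def)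
  qed
  obtain x where x: "x \<in> X m" using \<open>X m \<noteq> {}\<close> by blast
  \<comment> \<open>A complement walk from \<open>x\<close> cannot leave \<open>X m\<close>, yet
    \<open>v\<close> is outside it.\<close>
  have "(adj (graph_compl G))\<^sup>*\<^sup>* x v"
    using C.connected v x vs by (auto simp: graph_connected_def X_def)
  then have "v \<in> X m"
  proof (induction rule: rtranclp_induct)
    case (step y z)
    then show ?case using complete[of y z] by auto
  qed (rule x)
  then show False using irr by (simp add: X_def)
qed

section \<open>Induced four-vertex paths and the structure they force\<close>

context connected_graph
begin

text \<open>A walk from \<open>u\<close> to \<open>v\<close> must leave the ball of radius 2 around
  \<open>u\<close>, which is \<open>R\<close>. The edge \<open>q w\<close> on which it does so has
  \<open>q\<close> at distance exactly 2, and a shortest path through \<open>q\<close> to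
  \<open>w\<close> is induced.\<close>

lemma induced_P4_without_common_neighbour:
  assumes "u \<in> verts G" "v \<in> verts G" "u \<noteq> v" "\<not> adj G u v" "\<not> common_neighbour G u v"
  obtains p q w where "induced_P4 G u p q w" "\<not> common_neighbour G u w"
proof -
  define R where "R z \<longleftrightarrow> z = u \<or> adj G u z \<or> common_neighbour G u z" for z
  have "(adj G)\<^sup>*\<^sup>* u v" using connected assms(1,2) by (simp add: graph_connected_def)
  then have "R v \<or> (\<exists>q w. adj G q w \<and> R q \<and> \<not> R w)"
    by (induction rule: rtranclp_induct) (auto simp: R_def)
  then obtain q w where q: "adj G q w" "R q" "\<not> R w" using assms(3-5) by (auto simp: R_def)
  have "common_neighbour G u q" "q \<noteq> u" "\<not> adj G u q"
    using q unfolding R_def common_neighbour_def by blast+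
  then obtain p where "adj G u p" "adj G p q" by (auto simp: common_neighbour_def)
  moreover have "\<not> adj G p w" "p \<noteq> w" "\<not> adj G u w" "u \<noteq> w" "\<not> common_neighbour G u w"
    using q(3) calculation unfolding R_def common_neighbour_def by blast+
  ultimately show thesis using that[of p q w] q(1) \<open>q \<noteq> u\<close> \<open>\<not> adj G u q\<close>
    unfolding induced_P4_def by blast
qed

lemma induced_P4_rev: "induced_P4 G a b c d \<Longrightarrow> induced_P4 G d c b a"
  unfolding induced_P4_def by (meson adj_commute)

lemma induced_P4_facts:
  assumes "induced_P4 G a b c d"
  shows "adj G a b" "adj G b a" "adj G b c" "adj G c b" "adj G c d" "adj G d c"
    "\<not> adj G a c" "\<not> adj G c a" "\<not> adj G b d" "\<not> adj G d b" "\<not> adj G a d" "\<not> adj G d a"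
    "a \<noteq> b" "a \<noteq> c" "a \<noteq> d" "b \<noteq> c" "b \<noteq> d" "c \<noteq> d"
    "a \<in> verts G" "b \<in> verts G" "c \<in> verts G" "d \<in> verts G"
proof -
  note P = assms[unfolded induced_P4_def]
  show "adj G a b" "adj G b c" "adj G c d" "\<not> adj G a c" "\<not> adj G b d" "\<not> adj G a d"
    "a \<noteq> c" "a \<noteq> d" "b \<noteq> d" using P by blast+
  show "adj G b a" "adj G c b" "adj G d c" "\<not> adj G c a" "\<not> adj G d b" "\<not> adj G d a"
    using P adj_commute by blast+
  show "a \<noteq> b" "b \<noteq> c" "c \<noteq> d" using P adj_irrefl by blast+
  show "a \<in> verts G" "b \<in> verts G" "c \<in> verts G" "d \<in> verts G" using P adj_verts by blast+
qed

text \<open>Leave out \<open>w\<close>, \<open>p\<close>, \<open>q\<close>. The vertex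
  \<open>u\<close> separates \<open>q\<close> from the other two. Both \<open>w\<close> and
  \<open>p\<close> are adjacent to \<open>u\<close>, so they are separated by distance:
  \<open>v\<close> is at distance 2 from \<open>p\<close> but not from \<open>w\<close>.\<close>

lemma eta_le_if_pendant_far:
  assumes "induced_P4 G u p q v" "\<not> common_neighbour G u v"
    and w: "adj G w u" "w \<noteq> p" "w \<noteq> v" and Nw: "\<And>z. adj G w z \<Longrightarrow> z = u"
  shows "eta G + 3 \<le> card (verts G)"
proof -
  note P = induced_P4_facts[OF assms(1)]
  have wV: "w \<in> verts G" and wq: "w \<noteq> q" "w \<noteq> u" "adj G u w"
    using w P(8) adj_verts adj_irrefl adj_commute by blast+
  have nw: "\<not> adj G w p" "\<not> adj G w q" "\<not> adj G w v" using Nw P by blast+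
  have "common_neighbour G p v" using P by (auto simp: common_neighbour_def)
  then have "graph_dist G p v = 2" using graph_dist_eq_2[of p v] P by simp
  moreover have "\<not> common_neighbour G w v"
    using Nw P unfolding common_neighbour_def by blast
  then have "graph_dist G w v \<noteq> 2" using graph_dist_eq_2[of w v] P wV by simp
  ultimately have 1: "separates v {w, p, q} w p"
    using P w by (simp add: separates_def)
  have 2: "separates u {w, p, q} w q" "separates u {w, p, q} p q"
    by (rule separatesI; use P w wq wV in simp)+
  show ?thesis
    by (rule eta_le_triple[of w p q u u v v u u]) (use P w wq nw 1 2 in simp_all)
qed

text \<open>Leave out the inner vertices \<open>b\<close>, \<open>c\<close> and the common neighbour
  \<open>x\<close>: their adjacencies to the ends \<open>a\<close>, \<open>d\<close> are 10, 01 and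
  11.\<close>

lemma eta_le_if_induced_P4_closes:
  assumes "induced_P4 G a b c d" "common_neighbour G a d"
  shows "eta G + 3 \<le> card (verts G)"
proof -
  obtain x where x: "adj G a x" "adj G x d" using assms(2) by (auto simp: common_neighbour_def)
  note P = assms(1)[unfolded induced_P4_def]
  have V: "b \<in> verts G" "c \<in> verts G" "x \<in> verts G" using P x adj_verts by blast+
  have ne: "b \<noteq> c" "b \<noteq> x" "c \<noteq> x" "a \<notin> {b, c, x}" "d \<notin> {b, c, x}"
    using P x adj_commute adj_irrefl by blast+
  have ad: "adj G b a" "adj G x a" "\<not> adj G c a" "\<not> adj G b d"
    using P x adj_commute by blast+
  show ?thesis
    by (rule eta_le_triple[of b c x a d a a d a])
      (use P x V ne ad in \<open>auto intro!: separatesI\<close>)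
qed

text \<open>Leaving out \<open>u\<close>, \<open>v\<close> and \<open>w\<close> must fail, so \<open>w\<close> has the same neighbours as \<open>u\<close> or \<open>v\<close> among the
  other vertices. If \<open>w\<close> had none, it would be pendant at an end of the path, and then \<open>w\<close> and the
  two inner vertices could be left out.\<close>

lemma far_pair_twins:
  assumes big: "card (verts G) \<le> eta G + 2"
    and P4: "induced_P4 G u p q v" and far: "\<not> common_neighbour G u v"
    and w: "w \<in> verts G" "w \<notin> {u, p, q, v}"
  shows "(\<forall>y. y \<notin> {u, v, w} \<longrightarrow> adj G w y = adj G u y) \<or>
    (\<forall>y. y \<notin> {u, v, w} \<longrightarrow> adj G w y = adj G v y)"
proof (rule ccontr)
  assume neg: "\<not> ?thesis"
  note P = P4[unfolded induced_P4_def]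
  have V: "u \<in> verts G" "p \<in> verts G" "q \<in> verts G" "v \<in> verts G" using P adj_verts by blast+
  have cn: "\<not> (adj G u x \<and> adj G v x)" for x
    using far adj_commute by (auto simp: common_neighbour_def)
  have com: "adj G p u" "adj G q p" "adj G v q" "\<not> adj G q u" "\<not> adj G v p" "\<not> adj G v u"
    using P adj_commute by blast+
  have ne: "p \<noteq> u" "p \<noteq> v" "q \<noteq> u" "q \<noteq> v" "u \<noteq> v" using P com adj_irrefl by blast+
  show False
  proof (cases "\<exists>z. adj G w z \<and> z \<notin> {u, v, w}")
    case True
    then obtain z where z: "adj G w z" "z \<notin> {u, v, w}" by blast
    obtain y where y: "y \<notin> {u, v, w}" "adj G w y \<noteq> adj G u y" using neg by blast
    obtain y' where y': "y' \<notin> {u, v, w}" "adj G w y' \<noteq> adj G v y'" using neg by blast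
    have "eta G + 3 \<le> card (verts G)"
    proof (rule eta_le_triple[of u v w p q z p y y'])
      show "separates y {u, v, w} u w" by (rule separatesI) (use y V w in auto)
      show "separates y' {u, v, w} v w" by (rule separatesI) (use y' V w in auto)
    qed (use P com z w V ne in \<open>auto intro!: separatesI\<close>)
    then show False using big by simp
  next
    case False
    then have Nw: "\<And>z. adj G w z \<Longrightarrow> z = u \<or> z = v" using adj_irrefl by blast
    have "(adj G)\<^sup>*\<^sup>* w u" "w \<noteq> u" using connected w V by (auto simp: graph_connected_def)
    then obtain x where x: "adj G w x" by (blast elim: converse_rtranclpE)
    have "eta G + 3 \<le> card (verts G)"
    proof (cases "x = u")
      case True
      have "\<not> adj G w v" using cn[of w] x True adj_commute by blast
      then show ?thesis 
        by (intro eta_le_if_pendant_far[of u p q v w]) (use x True P4 far w Nw in auto)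
    next
      case False
      then have "x = v" using Nw x by blast
      have "\<not> adj G w u" using cn[of w] x \<open>x = v\<close> adj_commute by blast
      then show ?thesis 
        by (intro eta_le_if_pendant_far[of v q p u w])
          (use x \<open>x = v\<close> induced_P4_rev[OF P4] far w Nw common_neighbour_commute in auto)
    qed
    then show False using big by simp
  qed
qed

lemma double_star_shapeI:
  assumes "c \<noteq> d" "adj G c d" "adj G c a" "a \<noteq> d" "adj G d b" "b \<noteq> c"
    and N: "\<And>w. w \<in> verts G \<Longrightarrow> w \<noteq> c \<Longrightarrow> w \<noteq> d \<Longrightarrow>
      (\<forall>y. adj G w y \<longleftrightarrow> y = c) \<or> (\<forall>y. adj G w y \<longleftrightarrow> y = d)"
  shows "double_star_shape G c d ({w. adj G c w} - {d}) ({w. adj G d w} - {c})"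
  unfolding double_star_shape_def
proof (intro conjI allI)
  have N1: "w = c \<or> w = d \<or>
      adj G c w \<and> \<not> adj G d w \<and> (\<forall>y. adj G w y \<longleftrightarrow> y = c) \<or>
      adj G d w \<and> \<not> adj G c w \<and> (\<forall>y. adj G w y \<longleftrightarrow> y = d)" if "w \<in> verts G" for w
    using N[OF that] adj_commute[of w c] adj_commute[of w d] assms(1) by metis
  have dc: "adj G d c" using assms(2) adj_commute by blast
  then have V: "c \<in> verts G" "d \<in> verts G" using adj_verts by blast+
  show "({w. adj G c w} - {d}) \<inter> ({w. adj G d w} - {c}) = {}"
  proof -
    have "\<not> (adj G c w \<and> adj G d w)" for w using N1[of w] adj_verts[of c w] by auto
    then show ?thesis by blast
  qed
  show "verts G = {c, d} \<union> ({w. adj G c w} - {d}) \<union> ({w. adj G d w} - {c})"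
    using N1 V adj_verts by blast
  show "adj G u v \<longleftrightarrow>
      u = c \<and> v = d \<or> u = d \<and> v = c \<or>
      u = c \<and> v \<in> {w. adj G c w} - {d} \<or> v = c \<and> u \<in> {w. adj G c w} - {d} \<or>
      u = d \<and> v \<in> {w. adj G d w} - {c} \<or> v = d \<and> u \<in> {w. adj G d w} - {c}" for u v
  proof (cases "u = c \<or> u = d")
    case True
    then show ?thesis using assms(1,2) dc by auto
  next
    case False
    then show ?thesis using N1[of u] adj_verts[of u v] adj_verts[of c u] adj_verts[of d u] by auto
  qed
qed (use assms in auto)

lemma extended_star_shapeI:
  assumes "c \<noteq> t" "\<not> adj G c t" "adj G t a" "adj G t b" "a \<noteq> b"
    and "e \<in> verts G" "e \<noteq> c" "e \<noteq> t" "\<not> adj G t e"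
    and N: "\<And>w y. w \<in> verts G \<Longrightarrow> w \<noteq> c \<Longrightarrow> w \<noteq> t \<Longrightarrow>
      adj G w y \<longleftrightarrow> y = c \<or> y = t \<and> adj G t w"
  shows "extended_star_shape G c t {w. adj G t w} {w \<in> verts G - {c, t}. \<not> adj G t w}"
  unfolding extended_star_shape_def
proof (intro conjI allI)
  have ct: "\<not> adj G t c" using assms(2) adj_commute by blast
  have tV: "t \<in> verts G" using assms(3) adj_verts by blast
  have "e \<in> verts G" "adj G e c" using N[of e c] assms(6-8) by auto
  then have cV: "c \<in> verts G" using adj_verts by blast
  have "finite {w. adj G t w}" by (rule finite_subset[OF _ finite_verts]) (use adj_verts in blast)
  then have "card {a, b} \<le> card {w. adj G t w}" by (rule card_mono) (use assms(3,4) in auto)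
  then show "2 \<le> card {w. adj G t w}" using assms(5) by simp
  show "verts G = {c, t} \<union> {w. adj G t w} \<union> {w \<in> verts G - {c, t}. \<not> adj G t w}"
    using cV tV adj_verts by blast
  show "adj G u v \<longleftrightarrow>
      u = c \<and> v \<in> {w. adj G t w} \<union> {w \<in> verts G - {c, t}. \<not> adj G t w} \<or>
      v = c \<and> u \<in> {w. adj G t w} \<union> {w \<in> verts G - {c, t}. \<not> adj G t w} \<or>
      u = t \<and> v \<in> {w. adj G t w} \<or> v = t \<and> u \<in> {w. adj G t w}" for u v
  proof (cases "u = c \<or> u = t")
    case True
    then show ?thesis
    proof
      assume u: "u = c"
      show ?thesis using N[of v c] adj_verts[of c v] adj_commute[of c v] assms(1,2) ct u
          adj_verts[of t v] by (cases "v = c \<or> v = t") auto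
    next
      assume u: "u = t"
      show ?thesis using assms(1) ct u by auto
    qed
  next
    case False
    then show ?thesis using N[of u v] adj_verts[of u v] adj_verts[of t u] by auto
  qed
qed (use assms(1,2,6-9) adj_commute[of c t] in auto)

text \<open>Every vertex off the path is either a twin of \<open>u\<close> attached to
  \<open>p\<close>, or is attached to \<open>q\<close> and perhaps to \<open>u\<close>. If
  \<open>p\<close> is the only neighbour of \<open>u\<close>, the centres are \<open>p\<close> and
  \<open>q\<close>. Otherwise a second neighbour \<open>x\<close> of \<open>u\<close> has no
  neighbours but \<open>q\<close> and \<open>u\<close>, so twins of \<open>u\<close> cannot exist,
  and the graph is an extended star with centre \<open>q\<close> and extra vertex
  \<open>u\<close>.\<close>

lemma far_pair_shape_if_pendant:
  assumes big: "card (verts G) \<le> eta G + 2"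
    and P4: "induced_P4 G u p q v" and far: "\<not> common_neighbour G u v"
    and pend: "\<And>z. adj G v z \<Longrightarrow> z = q"
  shows "(\<exists>c d A B. double_star_shape G c d A B) \<or> (\<exists>c t M P. extended_star_shape G c t M P)"
proof -
  note P = induced_P4_facts[OF P4]
  have Nv: "adj G v y \<longleftrightarrow> y = q" for y using pend P by blast
  have pend': "adj G z v \<longleftrightarrow> z = q" for z using Nv adj_commute by blast
  \<comment> \<open>A triangle \<open>u\<close>, \<open>p\<close>, \<open>x\<close> is impossible:
    \<open>u\<close>, \<open>v\<close>, \<open>p\<close> have adjacencies 10, 01, 11 to
    \<open>x\<close>, \<open>q\<close> and could all be left out.\<close>
  have notp: "\<not> adj G x p" if x: "adj G u x" for x
  proof
    assume xp: "adj G x p"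
    have x': "x \<noteq> p" "x \<noteq> q" "x \<noteq> v" "x \<noteq> u" "\<not> adj G v x" "adj G p x" "x \<in> verts G"
      using x xp P pend adj_commute adj_irrefl adj_verts by blast+
    have "eta G + 3 \<le> card (verts G)"
      by (rule eta_le_triple[of u v p x q q x q x])
        (use P x xp x' in \<open>auto intro: separatesI\<close>)
    then show False using big by simp
  qed
  \<comment> \<open>\<open>far_pair_twins\<close> says nothing about adjacencies among
    \<open>u\<close>, \<open>v\<close>, \<open>w\<close>; they are settled by \<open>notp\<close>
    and by \<open>v\<close> being pendant.\<close>
  have W: "(\<forall>y. adj G w y \<longleftrightarrow> adj G u y) \<and> adj G w p \<or>
      (\<forall>y. adj G w y \<longleftrightarrow> y = q \<or> y = u \<and> adj G u w)"
    if w: "w \<in> verts G" "w \<notin> {u, p, q, v}" for w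
    using far_pair_twins[OF big P4 far w]
  proof
    assume tw: "\<forall>y. y \<notin> {u, v, w} \<longrightarrow> adj G w y = adj G u y"
    have wp: "adj G w p" using tw[rule_format, of p] w P by auto
    then have uw: "\<not> adj G u w" "\<not> adj G w u" using notp[of w] adj_commute[of u w] by blast+
    have "adj G w y \<longleftrightarrow> adj G u y" for y
    proof -
      consider "y = u" | "y = v" | "y = w" | "y \<notin> {u, v, w}" by blast
      then show ?thesis
        using tw[rule_format, of y] uw pend'[of w] w P by cases simp_all
    qed
    then show ?thesis using wp by blast
  next
    assume tw: "\<forall>y. y \<notin> {u, v, w} \<longrightarrow> adj G w y = adj G v y"
    have "adj G w y \<longleftrightarrow> y = q \<or> y = u \<and> adj G u w" for y
    proof -
      consider "y = u" | "y = v" | "y = w" | "y \<notin> {u, v, w}" by blast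
      then show ?thesis
        using tw[rule_format, of y] pend'[of w] w P Nv[of y] adj_commute[of u w] by cases auto
    qed
    then show ?thesis by blast
  qed
  show ?thesis
  proof (cases "\<exists>x. adj G u x \<and> x \<noteq> p")
    case False
    then have Nu: "adj G u y \<longleftrightarrow> y = p" for y using P by blast
    have "double_star_shape G p q ({w. adj G p w} - {q}) ({w. adj G q w} - {p})"
    proof (rule double_star_shapeI[of p q u v])
      fix w assume w: "w \<in> verts G" "w \<noteq> p" "w \<noteq> q"
      then show "(\<forall>y. adj G w y \<longleftrightarrow> y = p) \<or> (\<forall>y. adj G w y \<longleftrightarrow> y = q)"
        using W[of w] Nu Nv by (cases "w = u \<or> w = v") auto
    qed (use P in auto)
    then show ?thesis by blast
  next
    case True
    then obtain x where x: "adj G u x" "x \<noteq> p" by blast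
    have x': "x \<in> verts G" "x \<notin> {u, p, q, v}" using x P adj_verts adj_irrefl by blast+
    have Nx: "adj G x y \<longleftrightarrow> y = q \<or> y = u" for y
      using W[OF x'] notp[OF x(1)] x(1) by blast
    have W': "adj G w y \<longleftrightarrow> y = q \<or> y = u \<and> adj G u w"
      if w: "w \<in> verts G" "w \<notin> {u, p, q, v}" for w y
    proof -
      have "\<not> adj G w x \<or> \<not> adj G u x" using Nx[of w] w adj_commute by blast
      then show ?thesis using W[OF w] x(1) by blast
    qed
    have "extended_star_shape G q u {w. adj G u w} {w \<in> verts G - {q, u}. \<not> adj G u w}"
    proof (rule extended_star_shapeI[of q u p x v])
      fix w y assume w: "w \<in> verts G" "w \<noteq> q" "w \<noteq> u"
      have "adj G p y \<longleftrightarrow> y = q \<or> y = u"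
      proof (cases "y \<in> {u, p, q, v}")
        case False
        then show ?thesis using W'[of y p] adj_commute[of y p] adj_verts[of p y] P by auto
      qed (use P in auto)
      then show "adj G w y \<longleftrightarrow> y = q \<or> y = u \<and> adj G u w"
        using W'[of w y] Nv P w by (cases "w = p \<or> w = v") auto
    qed (use P x in auto)
    then show ?thesis by blast
  qed
qed

text \<open>It remains to exclude further neighbours \<open>x\<close> of \<open>u\<close> and
  \<open>y\<close> of \<open>v\<close> at the same time. Triangles \<open>u p x\<close> and
  \<open>v q y\<close> allow three omissions. So \<open>x\<close> resembles \<open>v\<close> and
  \<open>y\<close> resembles \<open>u\<close>, which gives the edges \<open>q x\<close> and
  \<open>p y\<close>.\<close>

lemma far_pair_shape:
  assumes big: "card (verts G) \<le> eta G + 2"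
    and P4: "induced_P4 G u p q v" and far: "\<not> common_neighbour G u v"
  shows "(\<exists>c d A B. double_star_shape G c d A B) \<or> (\<exists>c t M P. extended_star_shape G c t M P)"
proof -
  note P = induced_P4_facts[OF P4]
  consider "\<And>z. adj G v z \<Longrightarrow> z = q" | "\<And>z. adj G u z \<Longrightarrow> z = p"
    | x y where "adj G u x" "x \<noteq> p" "adj G v y" "y \<noteq> q" by blast
  then show ?thesis
  proof cases
    case 1
    then show ?thesis using far_pair_shape_if_pendant[OF big P4 far] by blast
  next
    case 2
    then show ?thesis
      using far_pair_shape_if_pendant[OF big induced_P4_rev[OF P4]] far common_neighbour_commute
      by blast
  next
    case 3
    note xy = this
    have cn: "\<not> (adj G u z \<and> adj G v z)" for z
      using far adj_commute by (auto simp: common_neighbour_def)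
    have ne: "x \<notin> {u, p, q, v}" "y \<notin> {u, p, q, v}" "x \<in> verts G" "y \<in> verts G"
      "\<not> adj G v x" "\<not> adj G u y" "adj G x u" "adj G y v" "x \<noteq> y"
      using xy P cn adj_verts adj_irrefl adj_commute by blast+
    have not_both: "\<not> (adj G x p \<and> adj G p x)"
    proof
      assume xp: "adj G x p \<and> adj G p x"
      have "eta G + 3 \<le> card (verts G)"
        by (rule eta_le_triple[of u v p x q q x q x])
          (use P xy ne xp in \<open>auto intro: separatesI\<close>)
      then show False using big by simp
    qed
    have not_both': "\<not> (adj G y q \<and> adj G q y)"
    proof
      assume yq: "adj G y q \<and> adj G q y"
      have "eta G + 3 \<le> card (verts G)"
        by (rule eta_le_triple[of v u q y p p y p y])
          (use P xy ne yq in \<open>auto intro: separatesI\<close>)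
      then show False using big by simp
    qed
    have xp: "\<not> adj G x p" "\<not> adj G p x" "\<not> adj G y q" "\<not> adj G q y"
      using not_both not_both' adj_commute by blast+
    have xq: "adj G q x" using far_pair_twins[OF big P4 far, of x] ne xp P adj_commute[of q x] by auto
    have yp: "adj G p y" using far_pair_twins[OF big P4 far, of y] ne xp P adj_commute[of p y] by auto
    \<comment> \<open>The adjacencies of \<open>p\<close>, \<open>q\<close>, \<open>u\<close> to
      \<open>x\<close>, \<open>y\<close>, \<open>v\<close> are 010, 101 and 100.\<close>
    have "eta G + 3 \<le> card (verts G)"
      by (rule eta_le_triple[of p q u y x x x y v])
        (use P xy ne xp xq yp in \<open>auto intro: separatesI\<close>)
    then show ?thesis using big by simp
  qed
qed

lemma induced_P4_exists:
  assumes "doubly_connected G" "2 \<le> card (verts G)"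
  obtains a b c d where "induced_P4 G a b c d"
proof (cases "\<exists>u v. u \<in> verts G \<and> v \<in> verts G \<and> u \<noteq> v \<and> \<not> adj G u v \<and> \<not> common_neighbour G u v")
  case True
  then show ?thesis using that induced_P4_without_common_neighbour by metis
next
  case False
  then show ?thesis
    using that induced_P4_exists_if_common_neighbours[OF simple _ assms(2)] assms(1)
    unfolding doubly_connected_def by blast
qed

lemma shape_if_eta_large:
  assumes "doubly_connected G" "2 \<le> card (verts G)" and big: "card (verts G) \<le> eta G + 2"
  shows "(\<exists>c d A B. double_star_shape G c d A B) \<or> (\<exists>c t M P. extended_star_shape G c t M P)"
proof -
  obtain a b c d where P4: "induced_P4 G a b c d"
    using induced_P4_exists[OF assms(1,2)] .
  have "\<not> common_neighbour G a d" using eta_le_if_induced_P4_closes[OF P4] big by auto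
  then show ?thesis using far_pair_shape[OF big P4] by blast
qed

end

section \<open>The extremal graphs\<close>

lemma double_star_shapeD:
  assumes "double_star_shape G c d A B"
  shows "c \<noteq> d" "c \<notin> A" "c \<notin> B" "d \<notin> A" "d \<notin> B" "A \<inter> B = {}" "A \<noteq> {}" "B \<noteq> {}"
    "verts G = {c, d} \<union> A \<union> B"
  using assms unfolding double_star_shape_def by simp_all

lemma double_star_shape_adj:
  assumes "double_star_shape G c d A B"
  shows "adj G u v \<longleftrightarrow>
    u = c \<and> v = d \<or> u = d \<and> v = c \<or> u = c \<and> v \<in> A \<or> v = c \<and> u \<in> A \<or>
    u = d \<and> v \<in> B \<or> v = d \<and> u \<in> B"
  using assms unfolding double_star_shape_def by (elim conjE) (erule allE)+

lemma extended_star_shapeD: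
  assumes "extended_star_shape G c t M P"
  shows "c \<noteq> t" "c \<notin> M" "c \<notin> P" "t \<notin> M" "t \<notin> P" "M \<inter> P = {}" "2 \<le> card M" "P \<noteq> {}"
    "verts G = {c, t} \<union> M \<union> P"
  using assms unfolding extended_star_shape_def by simp_all

lemma extended_star_shape_adj:
  assumes "extended_star_shape G c t M P"
  shows "adj G u v \<longleftrightarrow>
    u = c \<and> v \<in> M \<union> P \<or> v = c \<and> u \<in> M \<union> P \<or> u = t \<and> v \<in> M \<or> v = t \<and> u \<in> M"
  using assms unfolding extended_star_shape_def by (elim conjE) (erule allE)+

lemma double_star_shape_swap:
  assumes S: "double_star_shape G c d A B"
  shows "double_star_shape G d c B A"
  unfolding double_star_shape_def
proof (intro conjI allI)
  show "adj G u v \<longleftrightarrow>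
    u = d \<and> v = c \<or> u = c \<and> v = d \<or> u = d \<and> v \<in> B \<or> v = d \<and> u \<in> B \<or>
    u = c \<and> v \<in> A \<or> v = c \<and> u \<in> A" for u v
    unfolding double_star_shape_adj[OF S] by blast
qed (use double_star_shapeD[OF S] in auto)

lemma ex_two_elements_if_card_ge_2:
  assumes "2 \<le> card T"
  shows "\<exists>u v. u \<in> T \<and> v \<in> T \<and> u \<noteq> v"
proof -
  obtain S where S: "S \<subseteq> T" "card S = 2" using obtain_subset_with_card_n[OF assms] .
  then obtain u v where "S = {u, v}" "u \<noteq> v" by (meson card_2_iff)
  then show ?thesis using S(1) by blast
qed

lemma card_Un3_le: "card (X \<union> Y \<union> Z) \<le> card X + card Y + card Z"
  using card_Un_le[of X Y] card_Un_le[of "X \<union> Y" Z] by linarith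

section \<open>Values on the double stars and extended stars\<close>

context connected_graph
begin

lemma card_Diff_le_1:
  assumes "\<And>u v. u \<in> T - D \<Longrightarrow> v \<in> T - D \<Longrightarrow> u = v" and "T \<subseteq> verts G"
  shows "card (T - D) \<le> 1"
proof -
  have "finite (T - D)" using assms(2) finite_subset[OF _ finite_verts] by blast
  then show ?thesis using assms(1) card_le_Suc0_iff_eq[of "T - D"] by auto
qed

text \<open>The leaves at one centre are twins, so at most one is omitted; an omitted leaf forces
  its only neighbour, the centre, into \<open>D\<close>. Hence each centre together with its leaves
  loses at most one vertex.\<close>

lemma double_star_eta_ge:
  assumes S: "double_star_shape G c d A B"
  shows "card (verts G) \<le> eta G + 2"
proof (rule eta_ge_omit)
  fix D assume D: "metric_locating_dominating G D"
  have half: "card ((insert c A) - D) \<le> 1" if S: "double_star_shape G c d A B" for c d A B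
  proof (rule card_Diff_le_1)
    note T = double_star_shapeD[OF S] and E = double_star_shape_adj[OF S]
    have twin: "u = v" if "u \<in> A - D" "v \<in> A - D" for u v
      by (rule mld_omits_one_twin[OF D, of A]) (use T that in \<open>auto simp: E\<close>)
    have c: "c \<in> D" if "u \<in> A" "u \<notin> D" for u
      using mld_dominates[OF D, of u] that T by (auto simp: E)
    show "u = v" if "u \<in> insert c A - D" "v \<in> insert c A - D" for u v
      using twin[of u v] c[of u] c[of v] that by auto
    show "insert c A \<subseteq> verts G" using T by (auto simp: E)
  qed
  have "verts G - D = (insert c A - D) \<union> (insert d B - D)"
    using double_star_shapeD[OF S] by auto
  then show "card (verts G - D) \<le> 2"
    using half[OF S] half[OF double_star_shape_swap[OF S]] card_Un_le[of "insert c A - D" "insert d B - D"]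
    by simp
qed

lemma double_star_eta_le:
  assumes S: "double_star_shape G c d A B"
  shows "eta G + 2 \<le> card (verts G)"
proof -
  note T = double_star_shapeD[OF S] and E = double_star_shape_adj[OF S]
  obtain a b where ab: "a \<in> A" "b \<in> B" using T by blast
  have "a \<noteq> b" "a \<in> verts G" "b \<in> verts G" using T ab by auto
  then show ?thesis
    by (intro eta_le_pair[of a b c d c]) (use T ab in \<open>auto intro!: separatesI simp: E\<close>)
qed

text \<open>Each of \<open>insert c P\<close>, \<open>M\<close> and \<open>{t}\<close> loses at most
  one vertex, so only a loss in all three must be excluded. Then \<open>c\<close> dominates the
  omitted \<open>m\<close> and stays, and without \<open>t\<close> nothing tells \<open>m\<close>
  from the omitted \<open>p\<close>.\<close>

lemma extended_star_eta_ge: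
  assumes S: "extended_star_shape G c t M P"
  shows "card (verts G) \<le> eta G + 2"
proof (rule eta_ge_omit)
  fix D assume D: "metric_locating_dominating G D"
  note T = extended_star_shapeD[OF S] and E = extended_star_shape_adj[OF S]
  have VD: "verts G - D = (insert c P - D) \<union> (M - D) \<union> ({t} - D)" using T by (auto simp: E)
  have c: "c \<in> D" if "u \<in> P" "u \<notin> D" for u
    using mld_dominates[OF D, of u] that T by (auto simp: E)
  have "card (insert c P - D) \<le> 1"
  proof (rule card_Diff_le_1)
    have twin: "u = v" if "u \<in> P - D" "v \<in> P - D" for u v
      by (rule mld_omits_one_twin[OF D, of P]) (use T that in \<open>auto simp: E\<close>)
    show "u = v" if "u \<in> insert c P - D" "v \<in> insert c P - D" for u v
      using twin[of u v] c[of u] c[of v] that by auto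
  qed (use T in \<open>auto simp: E\<close>)
  moreover have M1: "card (M - D) \<le> 1"
  proof (rule card_Diff_le_1)
    show "u = v" if "u \<in> M - D" "v \<in> M - D" for u v
      by (rule mld_omits_one_twin[OF D, of M]) (use T that in \<open>auto simp: E\<close>)
  qed (use T in \<open>auto simp: E\<close>)
  moreover have "insert c P - D = {} \<or> M - D = {} \<or> {t} - D = {}"
  proof (rule ccontr)
    assume neg: "\<not> ?thesis"
    then obtain m where m: "m \<in> M" "m \<notin> D" and t: "t \<notin> D" by blast
    have "c \<in> D" using mld_dominates[OF D, of m] m t T by (auto simp: E)
    then obtain p where p: "p \<in> P" "p \<notin> D" using neg by blast
    obtain x where x: "x \<in> D" "graph_dist G m x \<noteq> graph_dist G p x"
      using mld_locates[OF D, of m p] m p T by (auto simp: E)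
    have xV: "x \<in> verts G" "x \<noteq> m" "x \<noteq> p" "x \<noteq> t" using x(1) mld_subset[OF D] m p t by auto
    have V: "m \<in> verts G" "p \<in> verts G" using m p T by (auto simp: E)
    show False
    proof (cases "x = c")
      case True
      then have "adj G m x" "adj G p x" using T m p by (auto simp: E)
      then show False using x(2) graph_dist_eq_1[of m x] graph_dist_eq_1[of p x] V xV by simp
    next
      case False
      \<comment> \<open>All other remaining vertices are leaves, at distance 2 from both
        \<open>m\<close> and \<open>p\<close> through \<open>c\<close>.\<close>
      then have "x \<in> M \<union> P" using xV T by blast
      then have "adj G m c" "adj G p c" "adj G c x" "\<not> adj G m x" "\<not> adj G p x"
        using T m p xV by (auto simp: E)
      then show False
        using x(2) graph_dist_eq_2[of m x] graph_dist_eq_2[of p x] V xV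
        unfolding common_neighbour_def by metis
    qed
  qed
  ultimately show "card (verts G - D) \<le> 2"
    using card_Un3_le[of "insert c P - D" "M - D" "{t} - D"] card_mono[of "{t}" "{t} - D"]
    unfolding VD[symmetric] by (elim disjE) simp_all
qed

lemma extended_star_eta_le:
  assumes S: "extended_star_shape G c t M P"
  shows "eta G + 2 \<le> card (verts G)"
proof -
  note T = extended_star_shapeD[OF S] and E = extended_star_shape_adj[OF S]
  obtain m where "m \<in> M" using T by fastforce
  moreover obtain p where "p \<in> P" using T by blast
  ultimately have mp: "m \<in> M" "p \<in> P" by auto
  have "m \<noteq> p" "m \<in> verts G" "p \<in> verts G" using T mp by auto
  then show ?thesis
    by (intro eta_le_pair[of m p c c t]) (use T mp in \<open>auto intro!: separatesI simp: E\<close>)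
qed

text \<open>Fits the complements of both families, where \<open>x\<close>, \<open>y\<close> are the
  two vertices other than the leaves. \<open>A\<close> and \<open>B\<close> are twin classes and
  lose at most one vertex each. If both do and \<open>x\<close>, \<open>y\<close> are omitted too,
  everything left is in the clique and adjacent to both omitted vertices of \<open>A\<close> and
  \<open>B\<close>.\<close>

lemma eta_ge_two_twin_cliques:
  assumes V: "verts G = {x, y} \<union> A \<union> B" and "A \<inter> B = {}"
    and clique: "\<And>u v. u \<in> A \<union> B \<Longrightarrow> v \<in> A \<union> B \<Longrightarrow> u \<noteq> v \<Longrightarrow> adj G u v"
    and A: "\<And>u v z. u \<in> A \<Longrightarrow> v \<in> A \<Longrightarrow> z \<in> {x, y} \<Longrightarrow> adj G u z \<longleftrightarrow> adj G v z"
    and B: "\<And>u v z. u \<in> B \<Longrightarrow> v \<in> B \<Longrightarrow> z \<in> {x, y} \<Longrightarrow> adj G u z \<longleftrightarrow> adj G v z"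
  shows "card (verts G) \<le> eta G + 3"
proof (rule eta_ge_omit)
  fix D assume D: "metric_locating_dominating G D"
  have twins: "card (T - D) \<le> 1"
    if T: "T \<subseteq> A \<union> B" "\<And>u v z. u \<in> T \<Longrightarrow> v \<in> T \<Longrightarrow> z \<in> {x, y} \<Longrightarrow> adj G u z \<longleftrightarrow> adj G v z" for T
  proof (rule card_Diff_le_1)
    show TV: "T \<subseteq> verts G" using T V by auto
    show "u = v" if uv: "u \<in> T - D" "v \<in> T - D" for u v
    proof (rule mld_omits_one_twin[OF D TV _ uv])
      fix u v z assume *: "u \<in> T" "v \<in> T" "z \<noteq> u" "z \<noteq> v"
      consider "z \<in> {x, y}" | "z \<in> A \<union> B" | "z \<notin> verts G" using V by blast
      then show "adj G u z \<longleftrightarrow> adj G v z"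
      proof cases
        case 1
        then show ?thesis using T(2) * by blast
      next
        case 2
        then show ?thesis using clique[of u z] clique[of v z] * T(1) by blast
      next
        case 3
        then show ?thesis using adj_verts by blast
      qed
    qed
  qed
  have VD: "verts G - D = (A - D) \<union> (B - D) \<union> ({x, y} - D)" using V by auto
  have "A - D = {} \<or> B - D = {} \<or> {x, y} \<inter> D \<noteq> {}"
  proof (rule ccontr)
    assume neg: "\<not> ?thesis"
    then obtain a b where ab: "a \<in> A" "a \<notin> D" "b \<in> B" "b \<notin> D" by blast
    have abV: "a \<in> verts G" "b \<in> verts G" "a \<noteq> b" using ab V assms(2) by auto
    then obtain z where z: "z \<in> D" "graph_dist G a z \<noteq> graph_dist G b z"
      using mld_locates[OF D] by blast
    then have "z \<in> A \<union> B" "z \<in> verts G" "z \<noteq> a" "z \<noteq> b"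
      using neg V mld_subset[OF D] ab by auto
    then show False
      using z(2) clique[of a z] clique[of b z] ab graph_dist_eq_1[of a z] graph_dist_eq_1[of b z] abV
      by simp
  qed
  moreover have "card ({x, y} - D) \<le> card {x, y}" by (rule card_mono) auto
  then have "card ({x, y} - D) \<le> 2" by (simp add: card_insert_if split: if_splits)
  moreover have "card ({x, y} - D) \<le> 1" if "{x, y} \<inter> D \<noteq> {}"
  proof -
    have "{x, y} - D \<subseteq> {x} \<or> {x, y} - D \<subseteq> {y}" using that by blast
    then show ?thesis using card_mono[of "{x}" "{x, y} - D"] card_mono[of "{y}" "{x, y} - D"] by auto
  qed
  ultimately show "card (verts G - D) \<le> 3"
    using twins[of A, OF _ A] twins[of B, OF _ B] card_Un3_le[of "A - D" "B - D" "{x, y} - D"]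
    unfolding VD[symmetric] by (elim disjE) simp_all
qed

end

section \<open>Complements of the double stars and extended stars\<close>

locale doubly_connected_graph =
  fixes G :: "'a ugraph"
  assumes simple: "simple_graph G" and doubly: "doubly_connected G"

sublocale doubly_connected_graph \<subseteq> connected_graph G
  using simple doubly by unfold_locales (auto simp: doubly_connected_def)

sublocale doubly_connected_graph \<subseteq> compl: connected_graph "graph_compl G"
  using simple doubly by unfold_locales (auto simp: doubly_connected_def simple_graph_compl)

context doubly_connected_graph
begin

lemma double_star_compl_eta_ge:
  assumes S: "double_star_shape G c d A B"
  shows "card (verts G) \<le> eta (graph_compl G) + 3"
proof -
  note T = double_star_shapeD[OF S] and E = double_star_shape_adj[OF S]
  have "card (verts (graph_compl G)) \<le> eta (graph_compl G) + 3"
    by (rule compl.eta_ge_two_twin_cliques[of c d A B]) (use T in \<open>auto simp: E\<close>)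
  then show ?thesis by simp
qed

lemma extended_star_compl_eta_ge:
  assumes S: "extended_star_shape G c t M P"
  shows "card (verts G) \<le> eta (graph_compl G) + 3"
proof -
  note T = extended_star_shapeD[OF S] and E = extended_star_shape_adj[OF S]
  have "card (verts (graph_compl G)) \<le> eta (graph_compl G) + 3"
    by (rule compl.eta_ge_two_twin_cliques[of c t M P]) (use T in \<open>auto simp: E\<close>)
  then show ?thesis by simp
qed

text \<open>Leave out \<open>a\<close>, \<open>b\<close>, \<open>d\<close>. In the complement the
  second leaf \<open>a'\<close> dominates all three, and \<open>c\<close> alone separates them: its
  distance is 2 from \<open>a\<close> (through \<open>b\<close>), 1 from \<open>b\<close>, and more
  than 2 from \<open>d\<close>.\<close>

lemma double_star_compl_eta_le_if_two_leaves:
  assumes S: "double_star_shape G c d A B" and aa: "a \<in> A" "a' \<in> A" "a \<noteq> a'"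
  shows "eta (graph_compl G) + 3 \<le> card (verts G)"
proof -
  note T = double_star_shapeD[OF S] and E = double_star_shape_adj[OF S]
  obtain b where b: "b \<in> B" using T by blast
  have V: "a \<in> verts G" "a' \<in> verts G" "b \<in> verts G" "c \<in> verts G" "d \<in> verts G"
    using T aa b by (auto simp: E)
  have "adj (graph_compl G) a b" "adj (graph_compl G) b c" using T aa b by (auto simp: E)
  then have "common_neighbour (graph_compl G) a c" unfolding common_neighbour_def by blast
  then have "graph_dist (graph_compl G) a c = 2"
    using compl.graph_dist_eq_2[of a c] T aa V by (auto simp: E)
  moreover have "\<not> common_neighbour (graph_compl G) d c"
    using T by (auto simp: E common_neighbour_def)
  then have "graph_dist (graph_compl G) d c \<noteq> 2" using compl.graph_dist_eq_2[of d c] V by auto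
  ultimately have "compl.separates c {a, b, d} a d"
    using T aa b V by (auto simp: E compl.separates_def)
  then have "eta (graph_compl G) + 3 \<le> card (verts (graph_compl G))"
    by (intro compl.eta_le_triple[of a b d a' a' a' c c c])
      (use T aa b V in \<open>auto intro!: compl.separatesI simp: E\<close>)
  then show ?thesis by simp
qed

text \<open>Leave out \<open>m\<close>, \<open>p\<close>, \<open>t\<close>. In the complement
  \<open>m'\<close> dominates \<open>m\<close> and \<open>p\<close>, and \<open>c\<close> dominates
  \<open>t\<close>, its only neighbour. So \<open>c\<close> is at distance 1 from \<open>t\<close>,
  2 from \<open>p\<close>, and more than 2 from \<open>m\<close>.\<close>

lemma extended_star_compl_eta_le:
  assumes S: "extended_star_shape G c t M P"
  shows "eta (graph_compl G) + 3 \<le> card (verts G)"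
proof -
  note T = extended_star_shapeD[OF S] and E = extended_star_shape_adj[OF S]
  obtain p where p: "p \<in> P" using T by blast
  obtain m m' where m: "m \<in> M" "m' \<in> M" "m \<noteq> m'"
    using ex_two_elements_if_card_ge_2[of M] T by blast
  have V: "m \<in> verts G" "m' \<in> verts G" "p \<in> verts G" "c \<in> verts G" "t \<in> verts G"
    using T m p by (auto simp: E)
  have "adj (graph_compl G) p t" "adj (graph_compl G) t c" using T m p by (auto simp: E)
  then have "common_neighbour (graph_compl G) p c" unfolding common_neighbour_def by blast
  then have "graph_dist (graph_compl G) p c = 2"
    using compl.graph_dist_eq_2[of p c] T p V by (auto simp: E)
  moreover have "\<not> common_neighbour (graph_compl G) m c"
    using T m by (auto simp: E common_neighbour_def)
  then have "graph_dist (graph_compl G) m c \<noteq> 2" using compl.graph_dist_eq_2[of m c] V by auto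
  ultimately have "compl.separates c {m, p, t} m p"
    using T m p V by (auto simp: E compl.separates_def)
  then have "eta (graph_compl G) + 3 \<le> card (verts (graph_compl G))"
    by (intro compl.eta_le_triple[of m p t m' m' c c c c])
      (use T m p V in \<open>auto intro!: compl.separatesI simp: E\<close>)
  then show ?thesis by simp
qed

lemma double_star_eta_sum:
  assumes S: "double_star_shape G c d A B" and n: "5 \<le> card (verts G)"
  shows "eta G + eta (graph_compl G) = 2 * card (verts G) - 5"
proof -
  note T = double_star_shapeD[OF S]
  \<comment> \<open>Order at least 5 puts two leaves at one of the centres, and the roles of the
    centres can be exchanged.\<close>
  have "card (verts G) \<le> card {c, d} + card A + card B"
    using T card_Un_le[of "{c, d}" A] card_Un_le[of "{c, d} \<union> A" B] by auto
  also have "card {c, d} = 2" using T by simp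
  finally have "2 \<le> card A \<or> 2 \<le> card B" using n by linarith
  then have "eta (graph_compl G) + 3 \<le> card (verts G)"
    using double_star_compl_eta_le_if_two_leaves[OF S]
      double_star_compl_eta_le_if_two_leaves[OF double_star_shape_swap[OF S]]
    using ex_two_elements_if_card_ge_2[of A] ex_two_elements_if_card_ge_2[of B] by blast
  then show ?thesis
    using double_star_compl_eta_ge[OF S] double_star_eta_ge[OF S] double_star_eta_le[OF S] by linarith
qed

lemma extended_star_eta_sum:
  assumes S: "extended_star_shape G c t M P"
  shows "eta G + eta (graph_compl G) = 2 * card (verts G) - 5"
  using extended_star_compl_eta_ge[OF S] extended_star_compl_eta_le[OF S] extended_star_eta_ge[OF S]
    extended_star_eta_le[OF S] by linarith

end

section \<open>Isomorphism\<close>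

locale graph_isomorphism =
  fixes G :: "'a ugraph" and H :: "'b ugraph" and f :: "'a \<Rightarrow> 'b"
  assumes simple_dom: "simple_graph G" and simple_cod: "simple_graph H"
    and bij: "bij_betw f (verts G) (verts H)"
    and adj_iff: "\<And>u v. u \<in> verts G \<Longrightarrow> v \<in> verts G \<Longrightarrow> adj H (f u) (f v) \<longleftrightarrow> adj G u v"

lemma graph_isoI: "graph_isomorphism G H f \<Longrightarrow> G \<simeq> H"
  unfolding graph_isomorphism_def graph_iso_def by blast

lemma graph_isoE:
  assumes "G \<simeq> H" "simple_graph G" "simple_graph H"
  obtains f where "graph_isomorphism G H f"
  using assms unfolding graph_isomorphism_def graph_iso_def by blast

context graph_isomorphism
begin

lemma inverse: "graph_isomorphism H G (inv_into (verts G) f)"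
proof
  show "bij_betw (inv_into (verts G) f) (verts H) (verts G)" by (rule bij_betw_inv_into[OF bij])
  show "adj G (inv_into (verts G) f u) (inv_into (verts G) f v) \<longleftrightarrow> adj H u v"
    if "u \<in> verts H" "v \<in> verts H" for u v
    using adj_iff[of "inv_into (verts G) f u" "inv_into (verts G) f v"] that
      bij_betw_inv_into_right[OF bij] bij_betwE[OF bij_betw_inv_into[OF bij]] by simp
qed (rule simple_cod simple_dom)+

lemma image_verts: "f ` verts G = verts H"
  using bij by (rule bij_betw_imp_surj_on)

lemma inj: "u \<in> verts G \<Longrightarrow> v \<in> verts G \<Longrightarrow> f u = f v \<longleftrightarrow> u = v"
  by (rule inj_on_eq_iff[OF bij_betw_imp_inj_on[OF bij]])

lemma in_verts: "u \<in> verts G \<Longrightarrow> f u \<in> verts H"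
  using image_verts by blast

lemma mem_image: "u \<in> verts G \<Longrightarrow> A \<subseteq> verts G \<Longrightarrow> f u \<in> f ` A \<longleftrightarrow> u \<in> A"
  by (rule inj_on_image_mem_iff[OF bij_betw_imp_inj_on[OF bij]])

lemma compl: "graph_isomorphism (graph_compl G) (graph_compl H) f"
proof
  show "bij_betw f (verts (graph_compl G)) (verts (graph_compl H))" using bij by simp
  show "adj (graph_compl H) (f u) (f v) \<longleftrightarrow> adj (graph_compl G) u v"
    if "u \<in> verts (graph_compl G)" "v \<in> verts (graph_compl G)" for u v
    using that by (simp add: adj_iff inj in_verts)
qed (rule simple_graph_compl simple_dom simple_cod)+

lemma relpowp_iff:
  "u \<in> verts G \<Longrightarrow> v \<in> verts G \<Longrightarrow> (adj H ^^ k) (f u) (f v) \<longleftrightarrow> (adj G ^^ k) u v"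
proof (induction k arbitrary: v)
  case 0
  then show ?case by (simp add: inj)
next
  case (Suc k)
  \<comment> \<open>The next-to-last vertex of a walk lies in the vertex set, so it has a preimage
    under \<open>f\<close>.\<close>
  have "(adj H ^^ Suc k) (f u) (f v) \<longleftrightarrow> (\<exists>y\<in>verts H. (adj H ^^ k) (f u) y \<and> adj H y (f v))"
    using simple_cod unfolding simple_graph_def by (auto simp: relcompp_apply)
  also have "\<dots> \<longleftrightarrow> (\<exists>x\<in>verts G. (adj H ^^ k) (f u) (f x) \<and> adj H (f x) (f v))"
    using image_verts by (metis (no_types, lifting) image_iff)
  also have "\<dots> \<longleftrightarrow> (\<exists>x\<in>verts G. (adj G ^^ k) u x \<and> adj G x v)"
    using Suc adj_iff by auto
  also have "\<dots> \<longleftrightarrow> (adj G ^^ Suc k) u v"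
    using simple_dom unfolding simple_graph_def by (auto simp: relcompp_apply)
  finally show ?case .
qed

lemma graph_dist_eq: "u \<in> verts G \<Longrightarrow> v \<in> verts G \<Longrightarrow> graph_dist H (f u) (f v) = graph_dist G u v"
  unfolding graph_dist_def by (simp add: relpowp_iff)

lemma connected_image:
  assumes "graph_connected G"
  shows "graph_connected H"
proof -
  have "(adj H)\<^sup>*\<^sup>* x y" if xy: "x \<in> verts H" "y \<in> verts H" for x y
  proof -
    obtain u v where uv: "x = f u" "y = f v" "u \<in> verts G" "v \<in> verts G"
      using xy image_verts by blast
    then have "(adj G)\<^sup>*\<^sup>* u v" using assms by (simp add: graph_connected_def)
    then show ?thesis using uv by (simp add: rtranclp_power relpowp_iff)
  qed
  moreover have "verts H \<noteq> {}" using assms image_verts unfolding graph_connected_def by blast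
  ultimately show ?thesis by (simp add: graph_connected_def)
qed

lemma mld_image:
  assumes D: "metric_locating_dominating G D"
  shows "metric_locating_dominating H (f ` D)" and "card (f ` D) = card D"
proof -
  have DV: "D \<subseteq> verts G" using D by (simp add: metric_locating_dominating_def dominating_def)
  have sub: "f ` D \<subseteq> verts H" using DV image_verts by blast
  have "\<exists>x\<in>f ` D. adj H v x" if "v \<in> verts H - f ` D" for v
  proof -
    obtain u where u: "v = f u" "u \<in> verts G" "u \<notin> D" using \<open>v \<in> _\<close> image_verts by blast
    then obtain x where "x \<in> D" "adj G u x"
      using D by (auto simp: metric_locating_dominating_def dominating_def)
    then show ?thesis using u adj_iff DV by blast
  qed
  moreover have "\<exists>x\<in>f ` D. graph_dist H u x \<noteq> graph_dist H v x"
    if uv: "u \<in> verts H" "v \<in> verts H" "u \<noteq> v" for u v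
  proof -
    obtain u' v' where u: "u = f u'" "v = f v'" "u' \<in> verts G" "v' \<in> verts G"
      using uv image_verts by blast
    then have "u' \<noteq> v'" using uv(3) by blast
    then obtain x where "x \<in> D" "graph_dist G u' x \<noteq> graph_dist G v' x"
      using D u(3,4) unfolding metric_locating_dominating_def locating_def by blast
    then show ?thesis using u graph_dist_eq DV by (metis image_eqI subsetD)
  qed
  ultimately show "metric_locating_dominating H (f ` D)"
    using sub by (simp add: metric_locating_dominating_def dominating_def locating_def)
  show "card (f ` D) = card D"
    by (rule card_image) (use inj DV in \<open>auto simp: inj_on_def\<close>)
qed

lemma eta_eq: "eta H = eta G"
proof -
  have le1: "\<exists>D. metric_locating_dominating H D \<and> card D = k"
    if "metric_locating_dominating G D" "card D = k" for D k
    using mld_image[OF that(1)] that(2) by blast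
  have le2: "\<exists>D. metric_locating_dominating G D \<and> card D = k"
    if "metric_locating_dominating H D" "card D = k" for D k
    using graph_isomorphism.mld_image[OF inverse that(1)] that(2) by blast
  have "(\<exists>D. metric_locating_dominating H D \<and> card D = k) \<longleftrightarrow>
    (\<exists>D. metric_locating_dominating G D \<and> card D = k)" for k
    using le1 le2 by blast
  then show ?thesis by (simp add: eta_def)
qed

lemma double_star_shape_image:
  assumes S: "double_star_shape G c d A B"
  shows "double_star_shape H (f c) (f d) (f ` A) (f ` B)"
proof -
  note D = double_star_shapeD[OF S] and E = double_star_shape_adj[OF S]
  have V: "c \<in> verts G" "d \<in> verts G" "A \<subseteq> verts G" "B \<subseteq> verts G" using D by auto
  have adjH: "adj H x y \<longleftrightarrow>
      x = f c \<and> y = f d \<or> x = f d \<and> y = f c \<or>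
      x = f c \<and> y \<in> f ` A \<or> y = f c \<and> x \<in> f ` A \<or> x = f d \<and> y \<in> f ` B \<or> y = f d \<and> x \<in> f ` B"
    for x y
  proof (cases "x \<in> verts H \<and> y \<in> verts H")
    case True
    then obtain u v where "x = f u" "y = f v" "u \<in> verts G" "v \<in> verts G" using image_verts by blast
    then show ?thesis using V by (simp add: adj_iff E inj mem_image)
  next
    case False
    then have "\<not> adj H x y" using simple_cod unfolding simple_graph_def by blast
    then show ?thesis using V False in_verts by blast
  qed
  have VH: "verts H = {f c, f d} \<union> f ` A \<union> f ` B"
    unfolding image_verts[symmetric] D(9) by blast
  have disj: "f ` A \<inter> f ` B = {}" using V inj D(6) by blast
  have ne: "f c \<noteq> f d" "f c \<notin> f ` A \<union> f ` B" "f d \<notin> f ` A \<union> f ` B"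
    using V D(1-5) inj by blast+
  show ?thesis
    unfolding double_star_shape_def image_is_empty by (intro conjI allI adjH VH disj ne D(7,8))
qed

lemma extended_star_shape_image:
  assumes S: "extended_star_shape G c t M P"
  shows "extended_star_shape H (f c) (f t) (f ` M) (f ` P)"
proof -
  note D = extended_star_shapeD[OF S] and E = extended_star_shape_adj[OF S]
  have V: "c \<in> verts G" "t \<in> verts G" "M \<subseteq> verts G" "P \<subseteq> verts G" using D by auto
  have adjH: "adj H x y \<longleftrightarrow>
      x = f c \<and> y \<in> f ` M \<union> f ` P \<or> y = f c \<and> x \<in> f ` M \<union> f ` P \<or>
      x = f t \<and> y \<in> f ` M \<or> y = f t \<and> x \<in> f ` M"
    for x y
  proof (cases "x \<in> verts H \<and> y \<in> verts H")
    case True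
    then obtain u v where "x = f u" "y = f v" "u \<in> verts G" "v \<in> verts G" using image_verts by blast
    then show ?thesis using V by (simp add: adj_iff E inj mem_image)
  next
    case False
    then have "\<not> adj H x y" using simple_cod unfolding simple_graph_def by blast
    then show ?thesis using V False in_verts by blast
  qed
  have VH: "verts H = {f c, f t} \<union> f ` M \<union> f ` P"
    unfolding image_verts[symmetric] D(9) by blast
  have disj: "f ` M \<inter> f ` P = {}" using V inj D(6) by blast
  have ne: "f c \<noteq> f t" "f c \<notin> f ` M \<union> f ` P" "f t \<notin> f ` M \<union> f ` P"
    using V D(1-5) inj by blast+
  have "card (f ` M) = card M"
    by (rule card_image) (use inj V in \<open>auto simp: inj_on_def\<close>)
  then have "2 \<le> card (f ` M)" using D(7) by simp
  then show ?thesis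
    unfolding extended_star_shape_def image_is_empty by (intro conjI allI adjH VH disj ne D(8))
qed

end

lemma graph_iso_sym:
  assumes "G \<simeq> H" "simple_graph G" "simple_graph H"
  shows "H \<simeq> G"
  by (rule graph_isoE[OF assms]) (rule graph_isoI[OF graph_isomorphism.inverse])

lemma graph_iso_compl:
  assumes "G \<simeq> H" "simple_graph G" "simple_graph H"
  shows "graph_compl G \<simeq> graph_compl H"
  by (rule graph_isoE[OF assms]) (rule graph_isoI[OF graph_isomorphism.compl])

lemma graph_iso_compl_left:
  assumes "simple_graph G" "simple_graph H"
  shows "graph_compl G \<simeq> H \<longleftrightarrow> G \<simeq> graph_compl H"
  using graph_iso_compl[of G "graph_compl H"] graph_iso_compl[of "graph_compl G" H] assms
  by (auto simp: simple_graph_compl graph_compl_compl)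

text \<open>The map sends \<open>c\<close>, \<open>d\<close>, \<open>A\<close>, \<open>B\<close> to \<open>c'\<close>, \<open>d'\<close>, \<open>A'\<close>, \<open>B'\<close>; the adjacency in both families of
  graphs depends on the class of a vertex only.\<close>

lemma ex_class_preserving_bij:
  assumes "c \<noteq> d" "c \<notin> A \<union> B" "d \<notin> A \<union> B" "A \<inter> B = {}" "finite A" "finite B"
    and "c' \<noteq> d'" "c' \<notin> A' \<union> B'" "d' \<notin> A' \<union> B'" "A' \<inter> B' = {}" "finite A'" "finite B'"
    and "card A = card A'" "card B = card B'"
  shows "\<exists>f. bij_betw f ({c, d} \<union> A \<union> B) ({c', d'} \<union> A' \<union> B') \<and>
    (\<forall>u \<in> {c, d} \<union> A \<union> B. (f u = c' \<longleftrightarrow> u = c) \<and> (f u = d' \<longleftrightarrow> u = d) \<and>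
      (f u \<in> A' \<longleftrightarrow> u \<in> A) \<and> (f u \<in> B' \<longleftrightarrow> u \<in> B))"
proof -
  obtain g h where g: "bij_betw g A A'" and h: "bij_betw h B B'"
    using finite_same_card_bij[of A A'] finite_same_card_bij[of B B'] assms by blast
  define f where "f x = (if x = c then c' else if x = d then d' else if x \<in> A then g x else h x)" for x
  have "bij_betw f A A' = bij_betw g A A'"
    by (rule bij_betw_cong) (use assms(1-4) in \<open>auto simp: f_def\<close>)
  moreover have "bij_betw f B B' = bij_betw h B B'"
    by (rule bij_betw_cong) (use assms(1-4) in \<open>auto simp: f_def\<close>)
  moreover have "bij_betw f {c, d} {c', d'}" using assms by (auto simp: f_def bij_betw_def)
  ultimately have bij: "bij_betw f ({c, d} \<union> A \<union> B) ({c', d'} \<union> A' \<union> B')"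
    using g h by (intro bij_betw_combine) (use assms(7-10) in auto)
  have gA: "g u \<in> A'" if "u \<in> A" for u using bij_betwE[OF g] that by blast
  have hB: "h u \<in> B'" if "u \<in> B" for u using bij_betwE[OF h] that by blast
  have "\<forall>u \<in> {c, d} \<union> A \<union> B. (f u = c' \<longleftrightarrow> u = c) \<and> (f u = d' \<longleftrightarrow> u = d) \<and>
      (f u \<in> A' \<longleftrightarrow> u \<in> A) \<and> (f u \<in> B' \<longleftrightarrow> u \<in> B)"
  proof (intro ballI)
    fix u assume "u \<in> {c, d} \<union> A \<union> B"
    then consider "u = c" | "u = d" | "u \<in> A" | "u \<in> B" by blast
    then show "(f u = c' \<longleftrightarrow> u = c) \<and> (f u = d' \<longleftrightarrow> u = d) \<and>
      (f u \<in> A' \<longleftrightarrow> u \<in> A) \<and> (f u \<in> B' \<longleftrightarrow> u \<in> B)"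
    proof cases
      case 3
      then have "f u \<in> A'" "u \<noteq> c" "u \<noteq> d" "u \<notin> B"
        using gA assms(1-4) by (auto simp: f_def)
      then show ?thesis using 3 assms(7-10) by auto
    next
      case 4
      then have "f u \<in> B'" "u \<noteq> c" "u \<noteq> d" "u \<notin> A"
        using hB assms(1-4) by (auto simp: f_def)
      then show ?thesis using 4 assms(7-10) by auto
    qed (use assms(1-4,7-10) in \<open>auto simp: f_def\<close>)
  qed
  then show ?thesis using bij by blast
qed

lemma double_star_shapes_iso:
  assumes S: "double_star_shape G c d A B" and S': "double_star_shape H c' d' A' B'"
    and "simple_graph G" "simple_graph H" "card A = card A'" "card B = card B'"
  shows "G \<simeq> H"
proof -
  note D = double_star_shapeD[OF S] and D' = double_star_shapeD[OF S']
  have "finite (verts G)" "finite (verts H)" using assms(3,4) by (auto simp: simple_graph_def)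
  then have fin: "finite A" "finite B" "finite A'" "finite B'" unfolding D D' by auto
  obtain f where f: "bij_betw f ({c, d} \<union> A \<union> B) ({c', d'} \<union> A' \<union> B')"
    "\<And>u. u \<in> {c, d} \<union> A \<union> B \<Longrightarrow> (f u = c' \<longleftrightarrow> u = c) \<and> (f u = d' \<longleftrightarrow> u = d) \<and>
      (f u \<in> A' \<longleftrightarrow> u \<in> A) \<and> (f u \<in> B' \<longleftrightarrow> u \<in> B)"
    using ex_class_preserving_bij[of c d A B c' d' A' B',
        OF D(1) _ _ D(6) fin(1,2) D'(1) _ _ D'(6) fin(3,4) assms(5,6)] D(2-5) D'(2-5)
    by (auto simp only: Un_iff)
  show ?thesis
    unfolding graph_iso_def D(9) D'(9)
    by (intro exI[of _ f] conjI ballI f(1))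
      (use f(2) in \<open>simp only: double_star_shape_adj[OF S] double_star_shape_adj[OF S']\<close>)
qed

lemma extended_star_shapes_iso:
  assumes S: "extended_star_shape G c t M P" and S': "extended_star_shape H c' t' M' P'"
    and "simple_graph G" "simple_graph H" "card M = card M'" "card P = card P'"
  shows "G \<simeq> H"
proof -
  note D = extended_star_shapeD[OF S] and D' = extended_star_shapeD[OF S']
  have "finite (verts G)" "finite (verts H)" using assms(3,4) by (auto simp: simple_graph_def)
  then have fin: "finite M" "finite P" "finite M'" "finite P'" unfolding D D' by auto
  obtain f where f: "bij_betw f ({c, t} \<union> M \<union> P) ({c', t'} \<union> M' \<union> P')"
    "\<And>u. u \<in> {c, t} \<union> M \<union> P \<Longrightarrow> (f u = c' \<longleftrightarrow> u = c) \<and> (f u = t' \<longleftrightarrow> u = t) \<and>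
      (f u \<in> M' \<longleftrightarrow> u \<in> M) \<and> (f u \<in> P' \<longleftrightarrow> u \<in> P)"
    using ex_class_preserving_bij[of c t M P c' t' M' P',
        OF D(1) _ _ D(6) fin(1,2) D'(1) _ _ D'(6) fin(3,4) assms(5,6)] D(2-5) D'(2-5)
    by (auto simp only: Un_iff)
  show ?thesis
    unfolding graph_iso_def D(9) D'(9)
    by (intro exI[of _ f] conjI ballI f(1))
      (use f(2) in \<open>simp only: Un_iff extended_star_shape_adj[OF S] extended_star_shape_adj[OF S']\<close>)
qed

section \<open>The numbered families as instances of the shapes\<close>

lemma simple_graph_from_edges:
  assumes "finite V" "S \<subseteq> V \<times> V" "\<And>v. (v, v) \<notin> S"
  shows "simple_graph (from_edges V S)"
  using assms unfolding simple_graph_def from_edges_def by auto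

lemma double_star_shape_double_star:
  assumes "1 \<le> r" "1 \<le> s"
  shows "double_star_shape (double_star r s) 0 1 {2..<r + 2} {r + 2..<r + s + 2}"
  unfolding double_star_shape_def
proof (intro conjI allI)
  show "adj (double_star r s) u v \<longleftrightarrow>
      u = 0 \<and> v = 1 \<or> u = 1 \<and> v = 0 \<or>
      u = 0 \<and> v \<in> {2..<r + 2} \<or> v = 0 \<and> u \<in> {2..<r + 2} \<or>
      u = 1 \<and> v \<in> {r + 2..<r + s + 2} \<or> v = 1 \<and> u \<in> {r + 2..<r + s + 2}" for u v
    unfolding double_star_def from_edges_def ugraph.simps Un_iff mem_Sigma_iff singleton_iff prod.inject
    by blast
qed (use assms in \<open>auto simp: double_star_def from_edges_def\<close>)

lemma extended_star_shape_extended_star: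
  assumes "2 \<le> s" "s \<le> r - 1"
  shows "extended_star_shape (extended_star r s) 0 (r + 1) {1..s} {s + 1..r}"
  unfolding extended_star_shape_def
proof (intro conjI allI)
  show "adj (extended_star r s) u v \<longleftrightarrow>
      u = 0 \<and> v \<in> {1..s} \<union> {s + 1..r} \<or> v = 0 \<and> u \<in> {1..s} \<union> {s + 1..r} \<or>
      u = r + 1 \<and> v \<in> {1..s} \<or> v = r + 1 \<and> u \<in> {1..s}" for u v
  proof -
    have *: "{1..r} = {1..s} \<union> {s + 1..r}" using assms by auto
    show ?thesis
      unfolding extended_star_def from_edges_def ugraph.simps Un_iff mem_Sigma_iff singleton_iff *
      by blast
  qed
qed (use assms in \<open>auto simp: extended_star_def from_edges_def\<close>)

lemma simple_double_star: "simple_graph (double_star r s)"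
  unfolding double_star_def by (rule simple_graph_from_edges) auto

lemma simple_extended_star: "s \<le> r - 1 \<Longrightarrow> simple_graph (extended_star r s)"
  unfolding extended_star_def by (rule simple_graph_from_edges) auto

lemma iso_double_star_iff:
  assumes "simple_graph G"
  shows "(\<exists>r s. r \<ge> 1 \<and> s \<ge> 1 \<and> G \<simeq> double_star r s) \<longleftrightarrow> (\<exists>c d A B. double_star_shape G c d A B)"
proof
  assume "\<exists>r s. r \<ge> 1 \<and> s \<ge> 1 \<and> G \<simeq> double_star r s"
  then obtain r s where "r \<ge> 1" "s \<ge> 1" and iso: "G \<simeq> double_star r s" by blast
  then have S: "double_star_shape (double_star r s) 0 1 {2..<r + 2} {r + 2..<r + s + 2}"
    by (intro double_star_shape_double_star)
  obtain f where "graph_isomorphism (double_star r s) G f"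
    using graph_isoE graph_iso_sym[OF iso] simple_double_star assms by metis
  from graph_isomorphism.double_star_shape_image[OF this S]
  show "\<exists>c d A B. double_star_shape G c d A B" by blast
next
  assume "\<exists>c d A B. double_star_shape G c d A B"
  then obtain c d A B where S: "double_star_shape G c d A B" by blast
  note D = double_star_shapeD[OF S]
  have "finite (verts G)" using assms by (simp add: simple_graph_def)
  then have AB: "card A \<ge> 1" "card B \<ge> 1" using D by (auto simp: Suc_le_eq card_gt_0_iff)
  then have "G \<simeq> double_star (card A) (card B)"
    by (intro double_star_shapes_iso[OF S double_star_shape_double_star] assms simple_double_star)
      simp_all
  then show "\<exists>r s. r \<ge> 1 \<and> s \<ge> 1 \<and> G \<simeq> double_star r s" using AB by blast
qed

text \<open>A shape with parts \<open>M\<close> and \<open>P\<close> corresponds to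
  \<open>s = card M\<close> and \<open>r = card M + card P\<close>; that \<open>P\<close> is
  non-empty is the condition \<open>s \<le> r - 1\<close>.\<close>

lemma iso_extended_star_iff:
  assumes "simple_graph G"
  shows "(\<exists>r s. 2 \<le> s \<and> s \<le> r - 1 \<and> G \<simeq> extended_star r s) \<longleftrightarrow>
    (\<exists>c t M P. extended_star_shape G c t M P)"
proof
  assume "\<exists>r s. 2 \<le> s \<and> s \<le> r - 1 \<and> G \<simeq> extended_star r s"
  then obtain r s where rs: "2 \<le> s" "s \<le> r - 1" and iso: "G \<simeq> extended_star r s" by blast
  then have S: "extended_star_shape (extended_star r s) 0 (r + 1) {1..s} {s + 1..r}"
    by (intro extended_star_shape_extended_star)
  obtain f where "graph_isomorphism (extended_star r s) G f"
    using graph_isoE graph_iso_sym[OF iso] simple_extended_star[OF rs(2)] assms by metis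
  from graph_isomorphism.extended_star_shape_image[OF this S]
  show "\<exists>c t M P. extended_star_shape G c t M P" by blast
next
  assume "\<exists>c t M P. extended_star_shape G c t M P"
  then obtain c t M P where S: "extended_star_shape G c t M P" by blast
  note D = extended_star_shapeD[OF S]
  have "finite (verts G)" using assms by (simp add: simple_graph_def)
  then have "card P \<ge> 1" using D by (auto simp: Suc_le_eq card_gt_0_iff)
  then have rs: "2 \<le> card M" "card M \<le> card M + card P - 1" using D(7) by linarith+
  then have "G \<simeq> extended_star (card M + card P) (card M)"
    by (intro extended_star_shapes_iso[OF S extended_star_shape_extended_star] assms
        simple_extended_star) simp_all
  then show "\<exists>r s. 2 \<le> s \<and> s \<le> r - 1 \<and> G \<simeq> extended_star r s" using rs by blast
qed

section \<open>The graphs with sum 4\<close>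

text \<open>Distances beyond 3 are truncated to 3, so the check is sufficient in general and necessary in
  graphs of diameter at most 3 only.\<close>

definition dist_upto_3 :: "'a ugraph \<Rightarrow> 'a list \<Rightarrow> 'a \<Rightarrow> 'a \<Rightarrow> nat" where
  "dist_upto_3 G vs u v =
     (if u = v then 0 else if adj G u v then 1
      else if list_ex (\<lambda>w. adj G u w \<and> adj G w v) vs then 2 else 3)"

definition mld_check :: "'a ugraph \<Rightarrow> 'a list \<Rightarrow> 'a list \<Rightarrow> bool" where
  "mld_check G vs D \<longleftrightarrow>
     (if list_all (\<lambda>v. v \<in> set D \<or> list_ex (adj G v) D) vs
      then list_all (\<lambda>u. list_all (\<lambda>v. u = v \<or>
        list_ex (\<lambda>x. dist_upto_3 G vs u x \<noteq> dist_upto_3 G vs v x) D) vs) vs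
      else False)"

context connected_graph
begin

lemma min_3_graph_dist:
  assumes "u \<in> verts G" "v \<in> verts G"
  shows "min 3 (graph_dist G u v) =
    (if u = v then 0 else if adj G u v then 1 else if common_neighbour G u v then 2 else 3)"
proof -
  have "u = v \<or> u \<noteq> v \<and> adj G u v \<or> u \<noteq> v \<and> \<not> adj G u v \<and> common_neighbour G u v \<or>
      u \<noteq> v \<and> \<not> adj G u v \<and> \<not> common_neighbour G u v" by blast
  then show ?thesis
    using graph_dist_eq_0[OF assms] graph_dist_eq_1[OF assms] graph_dist_eq_2[OF assms]
    by (elim disjE) auto
qed

lemma dist_upto_3_eq:
  assumes "verts G = set vs" "u \<in> verts G" "v \<in> verts G"
  shows "dist_upto_3 G vs u v = min 3 (graph_dist G u v)"
proof -
  have "list_ex (\<lambda>w. adj G u w \<and> adj G w v) vs \<longleftrightarrow> common_neighbour G u v"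
    using assms(1) adj_verts unfolding list_ex_iff common_neighbour_def by blast
  then show ?thesis by (simp add: min_3_graph_dist[OF assms(2,3)] dist_upto_3_def)
qed

lemma mld_if_mld_check:
  assumes V: "verts G = set vs" and D: "set D \<subseteq> set vs" and check: "mld_check G vs D"
  shows "metric_locating_dominating G (set D)"
proof -
  have dom: "v \<in> set D \<or> (\<exists>x\<in>set D. adj G v x)" if "v \<in> set vs" for v
    using check that unfolding mld_check_def list_all_iff list_ex_iff by (auto split: if_splits)
  have loc: "\<exists>x\<in>set D. graph_dist G u x \<noteq> graph_dist G v x"
    if uv: "u \<in> set vs" "v \<in> set vs" "u \<noteq> v" for u v
  proof -
    obtain x where x: "x \<in> set D" "dist_upto_3 G vs u x \<noteq> dist_upto_3 G vs v x"
      using check uv unfolding mld_check_def list_all_iff list_ex_iff by (metis (no_types))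
    then have "graph_dist G u x \<noteq> graph_dist G v x"
      using dist_upto_3_eq[OF V, of u x] dist_upto_3_eq[OF V, of v x] uv D V by auto
    then show ?thesis using x(1) by blast
  qed
  show ?thesis
    unfolding metric_locating_dominating_def dominating_def locating_def V
    using D dom loc by blast
qed

lemma mld_check_if_mld:
  assumes V: "verts G = set vs" and D: "metric_locating_dominating G (set D)"
    and diam: "\<And>u v. u \<in> verts G \<Longrightarrow> v \<in> verts G \<Longrightarrow> graph_dist G u v \<le> 3"
  shows "mld_check G vs D"
proof -
  have loc: "\<exists>x\<in>set D. dist_upto_3 G vs u x \<noteq> dist_upto_3 G vs v x"
    if uv: "u \<in> set vs" "v \<in> set vs" "u \<noteq> v" for u v
  proof -
    obtain x where "x \<in> set D" "graph_dist G u x \<noteq> graph_dist G v x"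
      using mld_locates[OF D, of u v] uv V by auto
    moreover have "x \<in> verts G" using mld_subset[OF D] calculation(1) by blast
    ultimately show ?thesis
      using dist_upto_3_eq[OF V, of u x] dist_upto_3_eq[OF V, of v x] diam[of u x] diam[of v x] uv V
      by (intro bexI[of _ x]) simp_all
  qed
  have "\<forall>v\<in>set vs. v \<in> set D \<or> (\<exists>x\<in>set D. adj G v x)"
    using mld_dominates[OF D] V by blast
  then show ?thesis
    unfolding mld_check_def list_all_iff list_ex_iff by (subst if_P) (use loc in blast)+
qed

text \<open>By domination, all vertices other than \<open>x\<close> are at distance 1 from a
  one-element set \<open>{x}\<close>, so it cannot separate two of them.\<close>

lemma eta_ge_2:
  assumes "3 \<le> card (verts G)"
  shows "2 \<le> eta G"
proof (rule ccontr)
  assume neg: "\<not> 2 \<le> eta G"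
  obtain D where D: "metric_locating_dominating G D" "card D = eta G" using eta_attained by blast
  have fin: "finite D" using mld_subset[OF D(1)] finite_subset finite_verts by blast
  obtain v where "v \<in> verts G" using assms by fastforce
  then have "D \<noteq> {}" using mld_dominates[OF D(1)] by blast
  then have "card D \<noteq> 0" using fin by simp
  then have "card D = 1" using neg D(2) by linarith
  then obtain x where x: "D = {x}" by (auto simp: card_1_singleton_iff)
  have "2 \<le> card (verts G - {x})" using assms by (auto simp: card_Diff_singleton_if)
  then obtain u v where uv: "u \<in> verts G - {x}" "v \<in> verts G - {x}" "u \<noteq> v"
    using ex_two_elements_if_card_ge_2 by blast
  then have "adj G u x" "adj G v x" using mld_dominates[OF D(1)] x by auto
  then have "graph_dist G u x = 1" "graph_dist G v x = 1"
    using graph_dist_eq_1 adj_verts by blast+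
  then show False using mld_locates[OF D(1), of u v] uv x by auto
qed

end

context doubly_connected_graph
begin

text \<open>Reduces the claim to two evaluations on the concrete graph \<open>H\<close>. The checks
  speak about true distances only in connected graphs, and \<open>H\<close> and its complement
  inherit connectedness from \<open>G\<close>.\<close>

lemma iso_eta_le_2_if_checks:
  assumes iso: "G \<simeq> H" and "simple_graph H" and V: "verts H = set vs"
    and D: "{i, j} \<subseteq> set vs" "mld_check H vs [i, j]"
    and D': "{k, l} \<subseteq> set vs" "mld_check (graph_compl H) vs [k, l]"
  shows "eta G \<le> 2 \<and> eta (graph_compl G) \<le> 2"
proof -
  have two: "card {i, j} \<le> 2" for i j by (simp add: card_insert_if)
  obtain f where f: "graph_isomorphism G H f" using graph_isoE[OF iso simple assms(2)] .
  note f' = graph_isomorphism.compl[OF f]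
  interpret H: connected_graph H
    using graph_isomorphism.connected_image[OF f connected] assms(2) by unfold_locales
  interpret H': connected_graph "graph_compl H"
    using graph_isomorphism.connected_image[OF f' compl.connected] simple_graph_compl[OF assms(2)]
    by unfold_locales
  have "eta H \<le> 2"
    using H.eta_le[OF H.mld_if_mld_check[OF V _ D(2)]] D(1) two[of i j] by auto
  moreover have "eta (graph_compl H) \<le> 2"
    using H'.eta_le[OF H'.mld_if_mld_check[OF _ _ D'(2)]] D'(1) V two[of k l] by auto
  ultimately show ?thesis
    using graph_isomorphism.eta_eq[OF f] graph_isomorphism.eta_eq[OF f'] by simp
qed

end

section \<open>The listed graphs have sum 4\<close>

lemma simple_path_5: "simple_graph path_5"
  and simple_cycle_5: "simple_graph cycle_5"
  and simple_bull: "simple_graph bull"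
  and simple_graph_E: "simple_graph graph_E"
  unfolding path_5_def cycle_5_def bull_def graph_E_def
  by (rule simple_graph_from_edges; simp)+

lemma verts_path_5: "verts path_5 = set [1..<6]"
  and verts_cycle_5: "verts cycle_5 = set [1..<6]"
  and verts_bull: "verts bull = set [1..<6]"
  and verts_graph_E: "verts graph_E = set [1..<7]"
  by (auto simp: path_5_def cycle_5_def bull_def graph_E_def from_edges_def)

text \<open>The pairs are explicit witnesses. In the path, 1, 3, 5 have distances (1,3), (1,1),
  (3,1) to 2, 4; in the complement, 2, 3, 4 have distances (2,1), (1,1), (1,2) to 1, 5.\<close>

lemma mld_checks_path_5:
  "mld_check path_5 [1..<6] [2, 4]" "mld_check (graph_compl path_5) [1..<6] [1, 5]"
  by code_simp+

lemma mld_checks_cycle_5: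
  "mld_check cycle_5 [1..<6] [1, 3]" "mld_check (graph_compl cycle_5) [1..<6] [1, 5]"
  by code_simp+

lemma mld_checks_bull:
  "mld_check bull [1..<6] [1, 2]" "mld_check (graph_compl bull) [1..<6] [4, 5]"
  by code_simp+

lemma mld_checks_graph_E:
  "mld_check graph_E [1..<7] [1, 5]" "mld_check (graph_compl graph_E) [1..<7] [1, 4]"
  by code_simp+

context doubly_connected_graph
begin

lemma eta_le_2_if_iso_listed:
  assumes "H \<in> {path_5, cycle_5, bull, house, graph_E, graph_F}" and iso: "G \<simeq> H"
  shows "eta G \<le> 2 \<and> eta (graph_compl G) \<le> 2"
proof -
  note V = verts_path_5 verts_cycle_5 verts_bull verts_graph_E
  consider "H = path_5" | "H = cycle_5" | "H = bull" | "H = house" | "H = graph_E" | "H = graph_F"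
    using assms(1) by blast
  then show ?thesis
  proof cases
    case 1
    show ?thesis
      by (rule iso_eta_le_2_if_checks[OF iso[unfolded 1] simple_path_5 _ _ mld_checks_path_5(1)
          _ mld_checks_path_5(2)]) (simp_all add: V)
  next
    case 2
    show ?thesis
      by (rule iso_eta_le_2_if_checks[OF iso[unfolded 2] simple_cycle_5 _ _ mld_checks_cycle_5(1)
          _ mld_checks_cycle_5(2)]) (simp_all add: V)
  next
    case 3
    show ?thesis
      by (rule iso_eta_le_2_if_checks[OF iso[unfolded 3] simple_bull _ _ mld_checks_bull(1)
          _ mld_checks_bull(2)]) (simp_all add: V)
  next
    case 4
    \<comment> \<open>The house is the complement of the path, so the same two checks serve with
      exchanged roles.\<close>
    note s = simple_path_5
    show ?thesis
      by (rule iso_eta_le_2_if_checks[OF iso[unfolded 4 house_def] simple_graph_compl[OF s] _ _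
          mld_checks_path_5(2), of 2 4]) (simp_all add: V graph_compl_compl[OF s] mld_checks_path_5 del: One_nat_def)
  next
    case 5
    show ?thesis
      by (rule iso_eta_le_2_if_checks[OF iso[unfolded 5] simple_graph_E _ _ mld_checks_graph_E(1)
          _ mld_checks_graph_E(2)]) (simp_all add: V)
  next
    case 6
    note s = simple_graph_E
    show ?thesis
      by (rule iso_eta_le_2_if_checks[OF iso[unfolded 6 graph_F_def] simple_graph_compl[OF s] _ _
          mld_checks_graph_E(2), of 1 5]) (simp_all add: V graph_compl_compl[OF s] mld_checks_graph_E del: One_nat_def)
  qed
qed

end

text \<open>Sends the i-th entry of \<open>xs\<close> to the i-th entry of \<open>ys\<close>; equal
  adjacency matrices can be verified by simplification.\<close>

lemma graph_iso_listI:
  assumes "distinct xs" "set xs = verts G" "distinct ys" "set ys = verts H" "length xs = length ys"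
    and eq: "map (\<lambda>u. map (adj G u) xs) xs = map (\<lambda>u. map (adj H u) ys) ys"
  shows "G \<simeq> H"
proof -
  define n where "n = length xs"
  have x: "bij_betw ((!) xs) {..<n} (verts G)" and y: "bij_betw ((!) ys) {..<n} (verts H)"
    using assms(1-5) by (auto simp: n_def intro!: bij_betw_nth)
  define f where "f = (!) ys \<circ> inv_into {..<n} ((!) xs)"
  have bij: "bij_betw f (verts G) (verts H)"
    unfolding f_def by (rule bij_betw_trans[OF bij_betw_inv_into[OF x] y])
  have "adj G u v \<longleftrightarrow> adj H (f u) (f v)" if uv: "u \<in> verts G" "v \<in> verts G" for u v
  proof -
    obtain i j where ij: "i < n" "j < n" "u = xs ! i" "v = xs ! j"
      using uv bij_betw_imp_surj_on[OF x] by blast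
    then have f: "f u = ys ! i" "f v = ys ! j"
      using bij_betw_inv_into_left[OF x] by (simp_all add: f_def)
    have "map (\<lambda>u. map (adj G u) xs) xs ! i ! j = map (\<lambda>u. map (adj H u) ys) ys ! i ! j"
      by (simp only: eq)
    then show ?thesis using ij f assms(5) by (simp add: n_def)
  qed
  then show ?thesis using bij unfolding graph_iso_def by blast
qed

section \<open>Order 5\<close>

context doubly_connected_graph
begin

text \<open>The graph is an induced path \<open>a b c d\<close> plus one vertex \<open>x\<close>. Of
  the 16 ways to attach \<open>x\<close>, connectedness excludes the empty one and connectedness of
  the complement the full one; the other 14 are identified one by one.\<close>

lemma iso_listed_if_order_5:
  assumes "card (verts G) = 5"
  shows "(\<exists>H \<in> {path_5, cycle_5, bull, house}. G \<simeq> H) \<or>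
    G \<simeq> double_star 2 1 \<or> G \<simeq> graph_compl (double_star 2 1) \<or>
    G \<simeq> extended_star 3 2 \<or> G \<simeq> graph_compl (extended_star 3 2)"
proof -
  have "2 \<le> card (verts G)" using assms by simp
  then obtain a b c d where P4: "induced_P4 G a b c d" by (rule induced_P4_exists[OF doubly])
  note P = induced_P4_facts[OF P4]
  have "card (verts G - {a, b, c, d}) = 1" using P assms by (simp add: card_Diff_subset)
  then obtain x where x: "verts G - {a, b, c, d} = {x}" by (auto simp: card_1_singleton_iff)
  then have V: "verts G = {a, b, c, d, x}" and xV: "x \<noteq> a" "x \<noteq> b" "x \<noteq> c" "x \<noteq> d" "x \<in> verts G"
    using P by blast+
  have nbr: "\<exists>y. adj H x y" if "graph_connected H" "verts H = verts G" for H :: "'a ugraph"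
  proof -
    have "(adj H)\<^sup>*\<^sup>* x a" using that P xV by (simp add: graph_connected_def)
    then show ?thesis using xV(1) by (blast elim: converse_rtranclpE)
  qed
  have some: "adj G x a \<or> adj G x b \<or> adj G x c \<or> adj G x d"
    using nbr[OF connected refl] adj_verts adj_irrefl V by (metis insertE singletonD)
  have notall: "\<not> adj G x a \<or> \<not> adj G x b \<or> \<not> adj G x c \<or> \<not> adj G x d"
    using nbr[OF compl.connected] V by auto
  have sym: "adj G a x = adj G x a" "adj G b x = adj G x b" "adj G c x = adj G x c"
    "adj G d x = adj G x d" by (rule adj_commute)+
  \<comment> \<open>In each case below, \<open>ys\<close> lists the images of \<open>a\<close>,
    \<open>b\<close>, \<open>c\<close>, \<open>d\<close>, \<open>x\<close> in this order.\<close>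
  have iso: "G \<simeq> H"
    if "distinct ys" "set ys = verts H" "length ys = 5"
      "map (\<lambda>u. map (adj G u) [a, b, c, d, x]) [a, b, c, d, x] = map (\<lambda>u. map (adj H u) ys) ys"
    for H :: "nat ugraph" and ys
    by (rule graph_iso_listI[of "[a, b, c, d, x]" G ys]) (use that P xV V in auto)
  note defs = path_5_def cycle_5_def bull_def house_def double_star_def extended_star_def
    from_edges_def
  consider
      "adj G x a" "\<not> adj G x b" "\<not> adj G x c" "\<not> adj G x d"
    | "\<not> adj G x a" "\<not> adj G x b" "\<not> adj G x c" "adj G x d"
    | "\<not> adj G x a" "adj G x b" "\<not> adj G x c" "\<not> adj G x d"
    | "\<not> adj G x a" "\<not> adj G x b" "adj G x c" "\<not> adj G x d"
    | "adj G x a" "adj G x b" "\<not> adj G x c" "\<not> adj G x d"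
    | "\<not> adj G x a" "\<not> adj G x b" "adj G x c" "adj G x d"
    | "adj G x a" "\<not> adj G x b" "adj G x c" "\<not> adj G x d"
    | "\<not> adj G x a" "adj G x b" "\<not> adj G x c" "adj G x d"
    | "adj G x a" "\<not> adj G x b" "\<not> adj G x c" "adj G x d"
    | "\<not> adj G x a" "adj G x b" "adj G x c" "\<not> adj G x d"
    | "adj G x a" "adj G x b" "adj G x c" "\<not> adj G x d"
    | "\<not> adj G x a" "adj G x b" "adj G x c" "adj G x d"
    | "adj G x a" "adj G x b" "\<not> adj G x c" "adj G x d"
    | "adj G x a" "\<not> adj G x b" "adj G x c" "adj G x d"
    using some notall by argo
  then show ?thesis
  proof cases
    case 1
    have "G \<simeq> path_5"
      by (rule iso[of "[2, 3, 4, 5, 1]"]) (auto simp: defs P sym xV 1)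
    then show ?thesis by blast
  next
    case 2
    have "G \<simeq> path_5"
      by (rule iso[of "[1, 2, 3, 4, 5]"]) (auto simp: defs P sym xV 2)
    then show ?thesis by blast
  next
    case 3
    have "G \<simeq> double_star 2 1"
      by (rule iso[of "[2, 0, 1, 4, 3]"]) (auto simp: defs P sym xV 3)
    then show ?thesis by blast
  next
    case 4
    have "G \<simeq> double_star 2 1"
      by (rule iso[of "[4, 1, 0, 2, 3]"]) (auto simp: defs P sym xV 4)
    then show ?thesis by blast
  next
    case 5
    have "G \<simeq> graph_compl (extended_star 3 2)"
      by (rule iso[of "[1, 3, 4, 0, 2]"]) (auto simp: defs P sym xV 5)
    then show ?thesis by blast
  next
    case 6
    have "G \<simeq> graph_compl (extended_star 3 2)"
      by (rule iso[of "[0, 4, 3, 1, 2]"]) (auto simp: defs P sym xV 6)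
    then show ?thesis by blast
  next
    case 7
    have "G \<simeq> extended_star 3 2"
      by (rule iso[of "[4, 1, 0, 3, 2]"]) (auto simp: defs P sym xV 7)
    then show ?thesis by blast
  next
    case 8
    have "G \<simeq> extended_star 3 2"
      by (rule iso[of "[3, 0, 1, 4, 2]"]) (auto simp: defs P sym xV 8)
    then show ?thesis by blast
  next
    case 9
    have "G \<simeq> cycle_5"
      by (rule iso[of "[1, 2, 3, 4, 5]"]) (auto simp: defs P sym xV 9)
    then show ?thesis by blast
  next
    case 10
    have "G \<simeq> bull"
      by (rule iso[of "[4, 1, 2, 5, 3]"]) (auto simp: defs P sym xV 10)
    then show ?thesis by blast
  next
    case 11
    have "G \<simeq> graph_compl (double_star 2 1)"
      by (rule iso[of "[1, 2, 4, 0, 3]"]) (auto simp: defs P sym xV 11)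
    then show ?thesis by blast
  next
    case 12
    have "G \<simeq> graph_compl (double_star 2 1)"
      by (rule iso[of "[0, 4, 2, 1, 3]"]) (auto simp: defs P sym xV 12)
    then show ?thesis by blast
  next
    case 13
    have "G \<simeq> house"
      by (rule iso[of "[3, 1, 4, 2, 5]"]) (auto simp: defs P sym xV 13)
    then show ?thesis by blast
  next
    case 14
    have "G \<simeq> house"
      by (rule iso[of "[4, 2, 5, 3, 1]"]) (auto simp: defs P sym xV 14)
    then show ?thesis by blast
  qed
qed

end

section \<open>Vertices at distance at least 3, and the classes outside a pair\<close>

context connected_graph
begin

text \<open>Distance at least 3, expressed through adjacency so that it translates directly to the
  complement.\<close>

definition far :: "'a \<Rightarrow> 'a \<Rightarrow> bool" where
  "far u v \<longleftrightarrow> u \<in> verts G \<and> v \<in> verts G \<and> u \<noteq> v \<and> \<not> adj G u v \<and> \<not> common_neighbour G u v"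

lemma farD:
  assumes "far u v"
  shows "u \<in> verts G" "v \<in> verts G" "u \<noteq> v" "\<not> adj G u v" "\<not> adj G v u"
    "adj G w u \<Longrightarrow> \<not> adj G w v" "adj G w v \<Longrightarrow> \<not> adj G w u"
    "adj G u w \<Longrightarrow> \<not> adj G w v" "adj G v w \<Longrightarrow> \<not> adj G w u"
    "adj G u w \<Longrightarrow> \<not> adj G v w"
  using assms adj_commute[of u v] adj_commute[of w u] adj_commute[of w v]
  unfolding far_def common_neighbour_def by blast+

lemma eta_2_obtain:
  assumes "eta G = 2"
  obtains x y where "x \<noteq> y" "metric_locating_dominating G {x, y}"
proof -
  obtain D where "metric_locating_dominating G D" "card D = 2"
    using eta_attained assms by metis
  moreover obtain x y where "D = {x, y}" "x \<noteq> y" using \<open>card D = 2\<close> unfolding card_2_iff by blast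
  ultimately show thesis using that by blast
qed

text \<open>At most one step leads onto the edge, one along it, and one from it to the
  target.\<close>

lemma graph_dist_le_3_if_dominating_edge:
  assumes "adj G a b" and dom: "\<And>w. w \<in> verts G \<Longrightarrow> w = a \<or> w = b \<or> adj G w a \<or> adj G w b"
    and uv: "u \<in> verts G" "v \<in> verts G"
  shows "graph_dist G u v \<le> 3"
proof -
  have walk: "\<exists>k \<le> 1. (adj G ^^ k) p q" if "p = q \<or> adj G p q" for p q
    using that
  proof
    assume "p = q"
    then have "(adj G ^^ 0) p q" by simp
    then show ?thesis by blast
  next
    assume "adj G p q"
    then have "(adj G ^^ 1) p q" by (simp only: relpowp_1)
    then show ?thesis by blast
  qed
  obtain c where c: "c \<in> {a, b}" "u = c \<or> adj G u c" using dom[OF uv(1)] by blast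
  obtain e where e: "e \<in> {a, b}" "e = v \<or> adj G e v"
    using dom[OF uv(2)] adj_commute[of v a] adj_commute[of v b] by blast
  have ce: "c = e \<or> adj G c e" using c(1) e(1) assms(1) adj_commute[of a b] by blast
  obtain k where k: "k \<le> 1" "(adj G ^^ k) u c" using walk[OF c(2)] by blast
  obtain m where m: "m \<le> 1" "(adj G ^^ m) c e" using walk[OF ce] by blast
  obtain l where l: "l \<le> 1" "(adj G ^^ l) e v" using walk[OF e(2)] by blast
  have "(adj G ^^ (k + m + l)) u v" unfolding relpowp_add using k(2) m(2) l(2) by blast
  from graph_dist_le[OF this] show ?thesis using k(1) l(1) m(1) by linarith
qed

text \<open>Outside a metric-locating-dominating pair \<open>x\<close>, \<open>y\<close> there are five kinds of vertices: those
  adjacent to both, and those adjacent to one and at distance 2, or far, from the other. In a graph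
  of diameter at most 3 each kind has at most one member.\<close>

definition only_near :: "'a \<Rightarrow> 'a \<Rightarrow> 'a set" where
  "only_near x y = {v \<in> verts G - {x, y}. adj G v x \<and> \<not> adj G v y \<and> \<not> far v y}"

definition only_far :: "'a \<Rightarrow> 'a \<Rightarrow> 'a set" where
  "only_far x y = {v. v \<noteq> x \<and> adj G v x \<and> far v y}"

definition near_both :: "'a \<Rightarrow> 'a \<Rightarrow> 'a set" where
  "near_both x y = {v. adj G v x \<and> adj G v y}"

lemma mld_pair_classes:
  assumes "metric_locating_dominating G {x, y}"
  shows "verts G = {x, y} \<union> only_near x y \<union> only_far x y \<union> only_near y x \<union> only_far y x \<union> near_both x y"
proof
  show "verts G \<subseteq> {x, y} \<union> only_near x y \<union> only_far x y \<union> only_near y x \<union> only_far y x \<union> near_both x y"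
  proof
    fix v assume v: "v \<in> verts G"
    show "v \<in> {x, y} \<union> only_near x y \<union> only_far x y \<union> only_near y x \<union> only_far y x \<union> near_both x y"
      using mld_dominates[OF assms v] v
      by (auto simp: only_near_def only_far_def near_both_def)
  qed
  show "{x, y} \<union> only_near x y \<union> only_far x y \<union> only_near y x \<union> only_far y x \<union> near_both x y \<subseteq> verts G"
    using mld_subset[OF assms] adj_verts farD(1)
    by (auto simp: only_near_def only_far_def near_both_def)
qed

lemma card_le_1_if_equal_dists:
  assumes D: "metric_locating_dominating G {x, y}" and "T \<subseteq> verts G"
    and T: "\<And>u. u \<in> T \<Longrightarrow> graph_dist G u x = i \<and> graph_dist G u y = j"
  shows "card T \<le> 1"
proof -
  have "card (T - {}) \<le> 1"
  proof (rule card_Diff_le_1[OF _ assms(2)])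
    fix u v assume uv: "u \<in> T - {}" "v \<in> T - {}"
    then have "\<forall>z \<in> {x, y}. graph_dist G u z = graph_dist G v z" using T[of u] T[of v] by simp
    then show "u = v" using mld_locates[OF D, of u v] uv assms(2) by blast
  qed
  then show ?thesis by simp
qed

lemma graph_dist_adj: "adj G u v \<Longrightarrow> graph_dist G u v = 1"
  using graph_dist_eq_1 adj_verts by blast

lemma card_only_near_le_1:
  assumes D: "metric_locating_dominating G {x, y}"
  shows "card (only_near x y) \<le> 1"
proof (rule card_le_1_if_equal_dists[OF D, where i = 1 and j = 2])
  fix u assume "u \<in> only_near x y"
  then have u: "u \<in> verts G" "adj G u x" "u \<noteq> y" "\<not> adj G u y" "\<not> far u y"
    by (auto simp: only_near_def)
  have y: "y \<in> verts G" using mld_subset[OF D] by simp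
  have "graph_dist G u y = 2" using graph_dist_eq_2[OF u(1) y] u y by (simp add: far_def)
  then show "graph_dist G u x = 1 \<and> graph_dist G u y = 2" using graph_dist_adj[OF u(2)] by simp
qed (auto simp: only_near_def)

lemma card_only_far_le_1:
  assumes D: "metric_locating_dominating G {x, y}"
    and diam: "\<And>u v. u \<in> verts G \<Longrightarrow> v \<in> verts G \<Longrightarrow> graph_dist G u v \<le> 3"
  shows "card (only_far x y) \<le> 1"
proof (rule card_le_1_if_equal_dists[OF D, where i = 1 and j = 3])
  fix u assume "u \<in> only_far x y"
  then have u: "adj G u x" "far u y" by (auto simp: only_far_def)
  note f = farD(1-4)[OF u(2)]
  have "min 3 (graph_dist G u y) = 3" using min_3_graph_dist[OF f(1,2)] u(2) by (simp add: far_def)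
  then show "graph_dist G u x = 1 \<and> graph_dist G u y = 3"
    using graph_dist_adj[OF u(1)] diam[OF f(1,2)] by simp
qed (use farD(1) in \<open>auto simp: only_far_def\<close>)

lemma card_near_both_le_1:
  assumes D: "metric_locating_dominating G {x, y}"
  shows "card (near_both x y) \<le> 1"
  by (rule card_le_1_if_equal_dists[OF D, where i = 1 and j = 1])
    (use graph_dist_adj adj_verts in \<open>auto simp: near_both_def\<close>)

lemma mld_pair_commute: "metric_locating_dominating G {x, y} \<longleftrightarrow> metric_locating_dominating G {y, x}"
  by (simp add: insert_commute)

lemma near_both_commute: "near_both x y = near_both y x"
  by (auto simp: near_both_def)

lemma card_Un5_le: "card (P \<union> A \<union> B \<union> C \<union> D \<union> E) \<le> card P + card A + card B + card C + card D + card E"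
  using card_Un3_le[of "P \<union> A \<union> B" C D] card_Un3_le[of P A B] card_Un_le[of "P \<union> A \<union> B \<union> C \<union> D" E]
  by linarith

lemma mld_pair_card:
  assumes D: "metric_locating_dominating G {x, y}"
  shows "card (verts G) \<le> 2 + card (only_near x y) + card (only_far x y) + card (only_near y x) +
    card (only_far y x) + card (near_both x y)"
proof -
  have "card {x, y} \<le> 2" by (simp add: card_insert_if)
  then show ?thesis
    using card_Un5_le[of "{x, y}" "only_near x y" "only_far x y" "only_near y x" "only_far y x" "near_both x y"]
    unfolding mld_pair_classes[OF D, symmetric] by linarith
qed

text \<open>Without far vertices only the distance vectors (1,1), (1,2), (2,1) remain outside the
  pair, which allows at most five vertices. Which member of the pair is the far one stays open,
  hence \<open>x'\<close> and \<open>y'\<close>.\<close>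

lemma mld_pair_far:
  assumes D: "metric_locating_dominating G {x, y}" and n: "6 \<le> card (verts G)"
  shows "\<exists>x' y' v. {x', y'} = {x, y} \<and> adj G v x' \<and> far v y'"
proof (rule ccontr)
  assume neg: "\<not> ?thesis"
  have "only_far x y = {}" "only_far y x = {}" using neg unfolding only_far_def by blast+
  moreover have "card (only_near x y) \<le> 1" "card (only_near y x) \<le> 1" "card (near_both x y) \<le> 1"
    using card_only_near_le_1 card_near_both_le_1 D mld_pair_commute[of x y] by blast+
  ultimately show False using mld_pair_card[OF D] n by simp
qed

end

text \<open>What the distances leave undetermined at order 6. The pair is 0, 1; vertex 2 is far from 1, vertex
  3 is at distance 2 from it, and the parameters are the adjacencies among the remaining vertices that
  are not forced.\<close>

definition bit_graph :: "bool \<Rightarrow> bool \<Rightarrow> bool \<Rightarrow> bool \<Rightarrow> nat ugraph" where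
  "bit_graph \<alpha> \<beta> \<gamma> \<delta> = from_edges {0..<6}
     (set ([(0,2), (0,3), (0,5), (1,4), (1,5)] @ (if \<alpha> then [(2,3)] else []) @
       (if \<beta> then [(3,5)] else []) @ (if \<gamma> then [(3,4)] else []) @ (if \<delta> then [(4,5)] else [])))"

text \<open>Twelve patterns have \<open>\<beta>\<close> or \<open>\<gamma>\<close>. The two missing
  from the list, (False, False, True, True) and (True, True, True, False), are the graphs E and F;
  in the complements of the other ten, every pair fails.\<close>

lemma bit_graph_check:
  "list_all (\<lambda>(\<alpha>, \<beta>, \<gamma>, \<delta>).
     list_all (\<lambda>i. list_all (\<lambda>j.
       \<not> mld_check (graph_compl (bit_graph \<alpha> \<beta> \<gamma> \<delta>)) [0..<6] [i, j]) [0..<i]) [0..<6])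
     [(False, False, True, False), (False, True, False, False), (False, True, False, True),
      (False, True, True, False), (False, True, True, True), (True, False, True, False),
      (True, False, True, True), (True, True, False, False), (True, True, False, True),
      (True, True, True, True)]"
  by code_simp

section \<open>Order at least 6\<close>

context doubly_connected_graph
begin

text \<open>A vertex adjacent in \<open>G\<close> to both \<open>a\<close> and \<open>b\<close>
  would be a common neighbour, so in the complement the edge \<open>a b\<close> is
  dominating.\<close>

lemma compl_dist_le_3_if_far:
  assumes "far a b" "u \<in> verts G" "v \<in> verts G"
  shows "graph_dist (graph_compl G) u v \<le> 3"
proof (rule compl.graph_dist_le_3_if_dominating_edge[of a b])
  fix w assume "w \<in> verts (graph_compl G)"
  then show "w = a \<or> w = b \<or> adj (graph_compl G) w a \<or> adj (graph_compl G) w b"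
    using farD[OF assms(1)] by auto
qed (use farD[OF assms(1)] assms in auto)

lemma compl_farD:
  assumes "compl.far a b"
  shows "adj G a b" "w \<in> verts G \<Longrightarrow> w = a \<or> w = b \<or> adj G w a \<or> adj G w b"
proof -
  note f = compl.farD[OF assms]
  show "adj G a b" using f(1-4) by simp
  show "w = a \<or> w = b \<or> adj G w a \<or> adj G w b" if w: "w \<in> verts G"
    using f(1,2) f(6)[of w] w by auto
qed

lemma dist_le_3_if_compl_far:
  assumes "compl.far a b" "u \<in> verts G" "v \<in> verts G"
  shows "graph_dist G u v \<le> 3"
  by (rule graph_dist_le_3_if_dominating_edge[OF compl_farD(1)[OF assms(1)] _ assms(2,3)])
    (rule compl_farD(2)[OF assms(1)])

text \<open>In the complement a pair fails to dominate a vertex outside it that is adjacent in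
  \<open>G\<close> to both members. If \<open>x' = x\<close>, this vertex is \<open>u\<close>.
  Otherwise \<open>x'\<close> is not among \<open>y\<close>, \<open>t\<close>, \<open>t2\<close>,
  because \<open>t2\<close> is adjacent to neither itself nor \<open>x'\<close> in the
  complement-free sense of \<open>G\<close>; so \<open>x'\<close> is adjacent to \<open>x\<close>,
  and the vertex is \<open>x\<close>.\<close>

lemma no_compl_mld_with_far_edge:
  assumes D: "metric_locating_dominating (graph_compl G) {x', u2}"
    and "adj (graph_compl G) t2 x'"
    and G: "adj G x u" "adj G x u2" "adj G u u2" "adj G t2 y" "adj G t2 t"
    and V: "\<And>z. z \<in> verts G \<Longrightarrow> z \<in> {x, y, u, u2, t, t2} \<or> adj G x z"
  shows False
proof -
  have x': "x' \<in> verts G" "x' \<noteq> t2" "\<not> adj G t2 x'" using assms(2) by auto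
  have in_V: "x \<in> verts G" "u \<in> verts G" using G adj_verts by blast+
  have ne: "x \<noteq> u" "x \<noteq> u2" "u \<noteq> u2" using G adj_irrefl by blast+
  show False
  proof (cases "x' = x")
    case True
    then have "adj (graph_compl G) u x \<or> adj (graph_compl G) u u2"
      using compl.mld_dominates[OF D, of u] in_V ne by auto
    then show False using G(1,3) adj_commute[of u x] by simp
  next
    case False
    then have "adj G x x'" using V[OF x'(1)] x'(2,3) G by blast
    moreover have "adj (graph_compl G) x x' \<or> adj (graph_compl G) x u2"
      using compl.mld_dominates[OF D, of x] in_V ne False by auto
    ultimately show False using G(2) by simp
  qed
qed

lemma adj_only_far:
  assumes "u \<in> only_far x y" "adj G u z"
  shows "\<not> adj G z y" "z \<noteq> y"
  using assms farD unfolding only_far_def by blast+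

text \<open>Excludes order 7, and order 6 with no common neighbour of \<open>x\<close> and
  \<open>y\<close>. The far pair \<open>v\<close>, \<open>y'\<close> of the complement is a
  dominating edge of \<open>G\<close>. The only possible neighbours of \<open>u\<close> are
  \<open>x\<close>, \<open>u2\<close>, those of \<open>t\<close> are \<open>y\<close>,
  \<open>t2\<close>, so the edge must join \<open>{u, x, u2}\<close> to \<open>{t, y, t2}\<close>,
  and only \<open>u2 t2\<close> can do that. To dominate \<open>u\<close> and \<open>t\<close> it
  then needs the edges \<open>u u2\<close> and \<open>t t2\<close>, and the complement pair contains
  \<open>u2\<close> or \<open>t2\<close>.\<close>

lemma not_all_classes_inhabited:
  assumes V: "verts G = {x, y, u, u2, t, t2} \<union> near_both x y"
    and u: "u \<in> only_far x y" "u2 \<in> only_near x y" and t: "t \<in> only_far y x" "t2 \<in> only_near y x"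
    and D: "metric_locating_dominating (graph_compl G) {x', y'}"
    and v: "adj (graph_compl G) v x'" "compl.far v y'"
  shows False
proof -
  have adj: "adj G u x" "adj G u2 x" "adj G t y" "adj G t2 y" "\<not> adj G u2 y" "\<not> adj G t2 x"
    using u t by (auto simp: only_far_def only_near_def)
  have Nu: "\<not> adj G z y" "z \<noteq> y" if "adj G u z" for z using adj_only_far[OF u(1) that] .
  have Nt: "\<not> adj G z x" "z \<noteq> x" if "adj G t z" for z using adj_only_far[OF t(1) that] .
  have adj': "adj G x u" "adj G x u2" "adj G y t" "adj G y t2" "\<not> adj G y u2" "\<not> adj G x t2"
    using adj adj_commute by blast+
  have xy: "\<not> adj G x y" "\<not> adj G y x" using Nu[OF adj(1)] Nt[OF adj(3)] by blast+
  have W: "adj G z x" "adj G z y" if "z \<in> near_both x y" for z using that by (auto simp: near_both_def)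
  have u_nbr: "z = x \<or> z = u2" if "adj G u z" for z
    using Nu[OF that] adj_verts[OF that] V W(2) adj that adj_irrefl by blast
  have t_nbr: "z = y \<or> z = t2" if "adj G t z" for z
    using Nt[OF that] adj_verts[OF that] V W(1) adj that adj_irrefl by blast
  have in_V: "u \<in> verts G" "t \<in> verts G" using V by auto
  have u_dom: "v \<in> {u, x, u2} \<or> y' \<in> {u, x, u2}"
    using compl_farD(2)[OF v(2) in_V(1)] u_nbr by blast
  have t_dom: "v \<in> {t, y, t2} \<or> y' \<in> {t, y, t2}"
    using compl_farD(2)[OF v(2) in_V(2)] t_nbr by blast
  have cross: "p = u2 \<and> q = t2" if pq: "p \<in> {u, x, u2}" "q \<in> {t, y, t2}" "adj G p q" for p q
  proof -
    have "p \<noteq> u" using pq Nu[of q] adj by blast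
    moreover have "q \<noteq> t" using pq Nt[of p] adj adj_commute[of p t] calculation by blast
    ultimately show ?thesis using pq adj adj' xy by blast
  qed
  have disj: "{u, x, u2} \<inter> {t, y, t2} = {}"
    using adj adj' xy Nu Nt adj_irrefl by blast
  have vy: "adj G v y'" "adj G y' v" using compl_farD(1)[OF v(2)] adj_commute by blast+
  have ends: "v = u2 \<and> y' = t2 \<or> v = t2 \<and> y' = u2"
    using u_dom t_dom cross[of v y'] cross[of y' v] vy disj by blast
  have "u \<noteq> u2" "t \<noteq> t2" using u t by (auto simp: only_far_def only_near_def)
  moreover have "u \<noteq> t2" "t \<noteq> u2" "\<not> adj G u t2" "\<not> adj G t u2" using Nu Nt disj adj by blast+
  ultimately have edge: "adj G u u2" "adj G t t2"
    using ends compl_farD(2)[OF v(2) in_V(1)] compl_farD(2)[OF v(2) in_V(2)] by auto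
  have edge': "adj G u2 u" "adj G t2 t" using edge adj_commute by blast+
  have near: "z \<in> {x, y, u, u2, t, t2} \<or> adj G x z \<and> adj G y z" if "z \<in> verts G" for z
    using that V W[of z] adj_commute[of z x] adj_commute[of z y] by blast
  show False
    using ends
  proof (elim disjE conjE)
    assume vy: "v = u2" "y' = t2"
    show False
    proof (rule no_compl_mld_with_far_edge[of x' t2 u2 y t x u])
      show "z \<in> {y, x, t, t2, u, u2} \<or> adj G y z" if "z \<in> verts G" for z
        using near[OF that] by blast
    qed (use D v(1) vy adj adj' edge edge' in simp_all)
  next
    assume vy: "v = t2" "y' = u2"
    show False
    proof (rule no_compl_mld_with_far_edge[of x' u2 t2 x u y t])
      show "z \<in> {x, y, u, u2, t, t2} \<or> adj G x z" if "z \<in> verts G" for z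
        using near[OF that] by blast
    qed (use D v(1) vy adj adj' edge edge' in simp_all)
  qed
qed

text \<open>The vertices in \<open>xs\<close> are numbered 0 to 5, and the four open adjacencies
  become the bits of \<open>bit_graph\<close>. The diameter bound for the complement makes the
  truncated check necessary for a pair, so \<open>bit_graph_check\<close> rules out all patterns but
  two.\<close>

lemma iso_E_or_F:
  assumes V: "verts G = set xs" and xs: "xs = [x, y, u, u2, t, w]" "distinct xs"
    and adj: "adj G x u" "adj G x u2" "adj G x w" "adj G y t" "adj G y w"
    and not_adj: "\<not> adj G x y" "\<not> adj G x t" "\<not> adj G y u" "\<not> adj G y u2" "\<not> adj G u w" "\<not> adj G u t"
    and "adj G u2 w \<or> adj G u2 t"
    and diam: "\<And>u v. u \<in> verts G \<Longrightarrow> v \<in> verts G \<Longrightarrow> graph_dist (graph_compl G) u v \<le> 3"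
    and D: "metric_locating_dominating (graph_compl G) {x', y'}" "x' \<noteq> y'"
  shows "G \<simeq> graph_E \<or> G \<simeq> graph_F"
proof -
  have sym: "adj G u x" "adj G u2 x" "adj G w x" "adj G t y" "adj G w y" "\<not> adj G y x" "\<not> adj G t x"
    "\<not> adj G u y" "\<not> adj G u2 y" "\<not> adj G w u" "\<not> adj G t u"
    using adj not_adj adj_commute by blast+
  note facts = adj not_adj sym
  define \<alpha> \<beta> \<gamma> \<delta> where bits: "\<alpha> = adj G u u2" "\<beta> = adj G u2 w" "\<gamma> = adj G u2 t" "\<delta> = adj G t w"
  have bits': "adj G u u2 = \<alpha>" "adj G u2 u = \<alpha>" "adj G u2 w = \<beta>" "adj G w u2 = \<beta>"
    "adj G u2 t = \<gamma>" "adj G t u2 = \<gamma>" "adj G t w = \<delta>" "adj G w t = \<delta>"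
    unfolding bits using adj_commute by blast+
  define H where "H = bit_graph \<alpha> \<beta> \<gamma> \<delta>"
  have VH: "verts H = set [0..<6]" by (simp add: H_def bit_graph_def from_edges_def)
  have simpleH: "simple_graph H"
    unfolding H_def bit_graph_def by (rule simple_graph_from_edges) (auto split: if_splits)
  have matrix: "map (\<lambda>a. map (adj G a) xs) xs =
    [[False, False, True, True, False, True], [False, False, False, False, True, True],
     [True, False, False, \<alpha>, False, False], [True, False, \<alpha>, False, \<gamma>, \<beta>],
     [False, True, False, \<gamma>, False, \<delta>], [True, True, False, \<beta>, \<delta>, False]]"
    unfolding xs by (simp add: facts bits')
  have "G \<simeq> H"
  proof (rule graph_iso_listI[OF xs(2) V[symmetric], of "[0..<6]"])
    have "[0..<6] = [0, 1, 2, 3, 4, 5]" by (simp add: upt_rec)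
    then show "map (\<lambda>a. map (adj G a) xs) xs = map (\<lambda>a. map (adj H a) [0..<6]) [0..<6]"
      unfolding matrix H_def bit_graph_def from_edges_def by simp
  qed (use VH xs in auto)
  then obtain f where f: "graph_isomorphism G H f" using graph_isoE simple simpleH by blast
  interpret f': graph_isomorphism "graph_compl G" "graph_compl H" f
    by (rule graph_isomorphism.compl[OF f])
  interpret H': connected_graph "graph_compl H"
    using f'.connected_image[OF compl.connected] simple_graph_compl[OF simpleH] by unfold_locales
  define i j where ij: "i = f x'" "j = f y'"
  have xV: "x' \<in> verts G" "y' \<in> verts G" using compl.mld_subset[OF D(1)] by auto
  then have ijV: "i < 6" "j < 6" "i \<noteq> j"
    using f'.in_verts[of x'] f'.in_verts[of y'] f'.inj[of x' y'] D(2) VH ij by auto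
  have mld: "metric_locating_dominating (graph_compl H) {i, j}"
    using f'.mld_image(1)[OF D(1)] by (simp add: ij)
  have diamH: "graph_dist (graph_compl H) p q \<le> 3"
    if "p \<in> verts (graph_compl H)" "q \<in> verts (graph_compl H)" for p q
  proof -
    have "p \<in> f ` verts (graph_compl G)" "q \<in> f ` verts (graph_compl G)"
      using that unfolding f'.image_verts by blast+
    then obtain p' q' where "p = f p'" "q = f q'" "p' \<in> verts G" "q' \<in> verts G"
      by (auto simp only: verts_graph_compl)
    then show ?thesis using f'.graph_dist_eq[of p' q'] diam[of p' q'] by simp
  qed
  \<comment> \<open>The evaluated table lists each unordered pair once, larger vertex first.\<close>
  have "\<exists>k<6. \<exists>l<k. mld_check (graph_compl H) [0..<6] [k, l]"
  proof (cases "j < i")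
    case True
    have "mld_check (graph_compl H) [0..<6] [i, j]"
      by (rule H'.mld_check_if_mld[OF _ _ diamH]) (use VH mld in simp_all)
    then show ?thesis using True ijV by blast
  next
    case False
    have "mld_check (graph_compl H) [0..<6] [j, i]"
      by (rule H'.mld_check_if_mld[OF _ _ diamH]) (use VH mld in \<open>simp_all add: insert_commute\<close>)
    then show ?thesis using False ijV by (meson linorder_neqE_nat)
  qed
  then obtain k l where kl: "k < 6" "l < k" "mld_check (graph_compl H) [0..<6] [k, l]" by blast
  have "(\<alpha>, \<beta>, \<gamma>, \<delta>) \<notin> set [(False, False, True, False), (False, True, False, False),
      (False, True, False, True), (False, True, True, False), (False, True, True, True),
      (True, False, True, False), (True, False, True, True), (True, True, False, False),
      (True, True, False, True), (True, True, True, True)]"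
    using kl bit_graph_check unfolding H_def list_all_iff by fastforce
  then consider "\<not> \<alpha>" "\<not> \<beta>" "\<gamma>" "\<delta>" | "\<alpha>" "\<beta>" "\<gamma>" "\<not> \<delta>"
    using assms(15) unfolding bits(2,3)[symmetric]
    by (cases \<alpha>; cases \<beta>; cases \<gamma>; cases \<delta>) auto
  then show ?thesis
  proof cases
    case 1
    have "G \<simeq> graph_E"
    proof (rule graph_iso_listI[OF xs(2) V[symmetric], of "[1, 5, 6, 4, 3, 2]"])
      show "map (\<lambda>a. map (adj G a) xs) xs =
          map (\<lambda>a. map (adj graph_E a) [1, 5, 6, 4, 3, 2]) [1, 5, 6, 4, 3, 2]"
        unfolding matrix graph_E_def from_edges_def using 1 by simp
      have "set [1, 5, 6, 4, 3, 2] = set [1..<7::nat]" by code_simp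
      then show "set [1, 5, 6, 4, 3, 2] = verts graph_E" by (simp only: verts_graph_E)
    qed (simp_all add: xs(1))
    then show ?thesis by blast
  next
    case 2
    have "G \<simeq> graph_F"
    proof (rule graph_iso_listI[OF xs(2) V[symmetric], of "[4, 1, 2, 6, 3, 5]"])
      show "map (\<lambda>a. map (adj G a) xs) xs =
          map (\<lambda>a. map (adj graph_F a) [4, 1, 2, 6, 3, 5]) [4, 1, 2, 6, 3, 5]"
        unfolding matrix graph_F_def graph_E_def from_edges_def using 2 by simp
      have "set [4, 1, 2, 6, 3, 5] = set [1..<7::nat]" by code_simp
      then show "set [4, 1, 2, 6, 3, 5] = verts graph_F"
        by (simp only: verts_graph_E graph_F_def verts_graph_compl)
    qed (simp_all add: xs(1))
    then show ?thesis by blast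
  qed
qed

text \<open>Since \<open>u2\<close> is at distance 2 from \<open>y\<close>, they have a common
  neighbour, and among the six vertices only \<open>t\<close> and \<open>w\<close> qualify. Whether
  \<open>t\<close> is far from \<open>x\<close> or at distance 2 does not matter: in both cases it
  is adjacent to \<open>y\<close> and not to \<open>x\<close>.\<close>

lemma iso_E_or_F_if_classes:
  assumes D: "metric_locating_dominating G {x, y}"
    and V: "verts G = {x, y, u, u2, t, w}"
    and u: "u \<in> only_far x y" "u2 \<in> only_near x y"
    and t: "t \<in> only_far y x \<union> only_near y x" and w: "w \<in> near_both x y"
    and D': "metric_locating_dominating (graph_compl G) {x', y'}" "x' \<noteq> y'"
  shows "G \<simeq> graph_E \<or> G \<simeq> graph_F"
proof -
  have far: "far u y" using u(1) by (simp add: only_far_def)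
  have adj: "adj G x u" "adj G x u2" "adj G x w" "adj G y t" "adj G y w"
    using u t w adj_commute by (auto simp: only_far_def only_near_def near_both_def)
  have Nu: "\<not> adj G z y" "\<not> adj G y z" "z \<noteq> y" if "adj G u z" for z
    using adj_only_far[OF u(1) that] adj_commute by blast+
  have "adj G u x" using u(1) by (simp add: only_far_def)
  then have xy: "x \<noteq> y" "\<not> adj G x y" "\<not> adj G y x" using Nu by blast+
  have u2: "u2 \<noteq> y" "\<not> adj G u2 y" "\<not> far u2 y" "u2 \<in> verts G" "y \<in> verts G"
    using u(2) V by (auto simp: only_near_def)
  have not_adj: "\<not> adj G x t" "\<not> adj G y u" "\<not> adj G y u2" "\<not> adj G u w" "\<not> adj G u t"
  proof -
    show "\<not> adj G x t" using t farD(5) by (auto simp: only_far_def only_near_def adj_commute)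
    show "\<not> adj G y u" using farD(5)[OF far] .
    show "\<not> adj G y u2" using u2(2) adj_commute by blast
    show "\<not> adj G u w" "\<not> adj G u t" using Nu adj by blast+
  qed
  have "common_neighbour G u2 y"
    using u2 by (auto simp: far_def)
  then obtain z where z: "adj G u2 z" "adj G z y" by (auto simp: common_neighbour_def)
  then have "z \<in> {x, y, u, u2, t, w}" using adj_verts V by blast
  then have "adj G u2 w \<or> adj G u2 t"
    using z xy not_adj adj_irrefl adj_commute by blast
  moreover have "distinct [x, y, u, u2, t, w]"
  proof -
    have "x \<noteq> u" "x \<noteq> u2" "x \<noteq> t" "x \<noteq> w" "y \<noteq> u" "y \<noteq> u2" "y \<noteq> t" "y \<noteq> w"
      "u \<noteq> t" "u \<noteq> w" "u2 \<noteq> t" "u2 \<noteq> w"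
      using adj not_adj xy adj_irrefl by blast+
    moreover have "t \<noteq> w" using adj not_adj by blast
    moreover have "u \<noteq> u2" using far u2(3) by blast
    ultimately show ?thesis using xy by simp
  qed
  moreover have "verts G = set [x, y, u, u2, t, w]" using V by simp
  moreover note compl_dist_le_3_if_far[OF far]
  ultimately show ?thesis
    by (intro iso_E_or_F[OF _ refl _ adj xy(2) not_adj _ _ D'])
qed

text \<open>Of the five classes at least four are inhabited. The case of all four one-sided classes
  is impossible; otherwise exactly one of them is empty and \<open>near_both x y\<close> is
  inhabited. The two remaining cases differ by exchanging \<open>x\<close> and
  \<open>y\<close>.\<close>

lemma iso_E_or_F_if_eta_2:
  assumes "eta G = 2" "eta (graph_compl G) = 2" and n: "6 \<le> card (verts G)"
  shows "G \<simeq> graph_E \<or> G \<simeq> graph_F"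
proof -
  obtain x y where "x \<noteq> y" and D: "metric_locating_dominating G {x, y}"
    using eta_2_obtain[OF assms(1)] .
  obtain x' y' where "x' \<noteq> y'" and D': "metric_locating_dominating (graph_compl G) {x', y'}"
    using compl.eta_2_obtain[OF assms(2)] .
  obtain a b v where ab: "{a, b} = {x', y'}" "adj (graph_compl G) v a" "compl.far v b"
    using compl.mld_pair_far[OF D'] n by auto
  have Dab: "metric_locating_dominating (graph_compl G) {a, b}" using D' ab(1) by simp
  have diam: "graph_dist G p q \<le> 3" if "p \<in> verts G" "q \<in> verts G" for p q
    using dist_le_3_if_compl_far[OF ab(3) that] .
  have D2: "metric_locating_dominating G {y, x}" using D mld_pair_commute by blast
  note le_1 = card_only_near_le_1[OF D] card_only_near_le_1[OF D2] card_only_far_le_1[OF D diam]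
    card_only_far_le_1[OF D2 diam] card_near_both_le_1[OF D]
  note le = mld_pair_card[OF D] n
  have sub: "only_near p q \<subseteq> verts G" "only_far p q \<subseteq> verts G" "near_both p q \<subseteq> verts G" for p q
    using adj_verts by (auto simp: only_near_def only_far_def near_both_def)
  have single: "\<exists>z. T = {z}" if "card T \<le> 1" "T \<subseteq> verts G" "T \<noteq> {}" for T
  proof -
    have "finite T" using that(2) finite_subset finite_verts by blast
    then have "card T = 1" using that by (metis One_nat_def card_0_eq le_SucE le_zero_eq)
    then show ?thesis by (rule card_1_singletonE) blast
  qed
  note V = mld_pair_classes[OF D]
  consider (all) "only_near x y \<noteq> {}" "only_far x y \<noteq> {}" "only_near y x \<noteq> {}" "only_far y x \<noteq> {}"
    | (right) "only_near x y \<noteq> {}" "only_far x y \<noteq> {}" "only_near y x = {} \<or> only_far y x = {}"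
    | (left) "only_near x y = {} \<or> only_far x y = {}" by blast
  then show ?thesis
  proof cases
    case all
    obtain u2 where u2: "only_near x y = {u2}" using single[OF le_1(1) sub(1) all(1)] by blast
    obtain u where u: "only_far x y = {u}" using single[OF le_1(3) sub(2) all(2)] by blast
    obtain t2 where t2: "only_near y x = {t2}" using single[OF le_1(2) sub(1) all(3)] by blast
    obtain t where t: "only_far y x = {t}" using single[OF le_1(4) sub(2) all(4)] by blast
    have "verts G = {x, y, u, u2, t, t2} \<union> near_both x y" using V u u2 t t2 by blast
    from not_all_classes_inhabited[OF this _ _ _ _ Dab ab(2,3)] u u2 t t2 show ?thesis by simp
  next
    case right
    obtain u2 where u2: "only_near x y = {u2}" using single[OF le_1(1) sub(1) right(1)] by blast
    obtain u where u: "only_far x y = {u}" using single[OF le_1(3) sub(2) right(2)] by blast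
    have "near_both x y \<noteq> {}" using right(3) le le_1 by auto
    then obtain w where w: "near_both x y = {w}" using single[OF le_1(5) sub(3)] by blast
    have "only_far y x \<noteq> {} \<or> only_near y x \<noteq> {}" using le le_1 by auto
    with right(3) obtain t where t: "only_far y x \<union> only_near y x = {t}"
      using single[OF le_1(2) sub(1)] single[OF le_1(4) sub(2)] by (metis Un_empty_left Un_empty_right)
    have "verts G = {x, y, u, u2, t, w}" unfolding V u u2 w using t by blast
    then show ?thesis
      by (rule iso_E_or_F_if_classes[OF D _ _ _ _ _ D' \<open>x' \<noteq> y'\<close>]) (simp_all add: u u2 t w)
  next
    case left
    have ne: "only_near y x \<noteq> {}" "only_far y x \<noteq> {}" using left le le_1 by auto
    obtain t2 where t2: "only_near y x = {t2}" using single[OF le_1(2) sub(1) ne(1)] by blast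
    obtain t where t: "only_far y x = {t}" using single[OF le_1(4) sub(2) ne(2)] by blast
    have "near_both x y \<noteq> {}" using left le le_1 by auto
    then obtain w where w: "near_both x y = {w}" using single[OF le_1(5) sub(3)] by blast
    have "only_far x y \<noteq> {} \<or> only_near x y \<noteq> {}" using le le_1 by auto
    with left obtain u where u: "only_far x y \<union> only_near x y = {u}"
      using single[OF le_1(1) sub(1)] single[OF le_1(3) sub(2)] by (metis Un_empty_left Un_empty_right)
    have "verts G = {y, x, t, t2, u, w}" unfolding V t t2 w using u by blast
    then show ?thesis
      by (rule iso_E_or_F_if_classes[OF D2 _ _ _ _ _ D' \<open>x' \<noteq> y'\<close>])
        (simp_all add: u t t2 w near_both_commute[of y x])
  qed
qed

end

section \<open>The bounds and the equality cases\<close>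

definition extremal :: "'a ugraph \<Rightarrow> bool" where
  "extremal G \<longleftrightarrow>
    (\<exists>c d A B. double_star_shape G c d A B) \<or> (\<exists>c t M P. extended_star_shape G c t M P)"

lemma doubly_connected_graph_compl:
  "doubly_connected_graph G \<Longrightarrow> doubly_connected_graph (graph_compl G)"
  unfolding doubly_connected_graph_def by (simp add: simple_graph_compl doubly_connected_compl)

lemma extremal_iff_iso:
  assumes "simple_graph G"
  shows "extremal G \<longleftrightarrow>
    (\<exists>r s. r \<ge> 1 \<and> s \<ge> 1 \<and> G \<simeq> double_star r s) \<or>
    (\<exists>r s. 2 \<le> s \<and> s \<le> r - 1 \<and> G \<simeq> extended_star r s)"
  unfolding extremal_def iso_double_star_iff[OF assms] iso_extended_star_iff[OF assms] ..

lemma extremal_or_compl_iff_iso: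
  assumes "simple_graph G"
  shows "extremal G \<or> extremal (graph_compl G) \<longleftrightarrow>
    (\<exists>r s. r \<ge> 1 \<and> s \<ge> 1 \<and>
      (G \<simeq> double_star r s \<or> G \<simeq> graph_compl (double_star r s))) \<or>
    (\<exists>r s. 2 \<le> s \<and> s \<le> r - 1 \<and>
      (G \<simeq> extended_star r s \<or> G \<simeq> graph_compl (extended_star r s)))"
proof -
  have "graph_compl G \<simeq> double_star r s \<longleftrightarrow> G \<simeq> graph_compl (double_star r s)" for r s
    by (rule graph_iso_compl_left[OF assms simple_double_star])
  moreover have "graph_compl G \<simeq> extended_star r s \<longleftrightarrow> G \<simeq> graph_compl (extended_star r s)"
    if "s \<le> r - 1" for r s
    by (rule graph_iso_compl_left[OF assms simple_extended_star[OF that]])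
  ultimately show ?thesis
    unfolding extremal_iff_iso[OF assms] extremal_iff_iso[OF simple_graph_compl[OF assms]]
    by blast
qed

context doubly_connected_graph
begin

lemma eta_sum_if_extremal:
  assumes "extremal G" "5 \<le> card (verts G)"
  shows "eta G + eta (graph_compl G) = 2 * card (verts G) - 5"
  using assms double_star_eta_sum extended_star_eta_sum unfolding extremal_def by blast

lemma eta_sum_if_compl_extremal:
  assumes "extremal (graph_compl G)" "5 \<le> card (verts G)"
  shows "eta G + eta (graph_compl G) = 2 * card (verts G) - 5"
proof -
  interpret C: doubly_connected_graph "graph_compl G"
    by (rule doubly_connected_graph_compl) unfold_locales
  show ?thesis
    using C.eta_sum_if_extremal assms by (simp add: graph_compl_compl[OF simple])
qed

lemma eta_le_if_not_extremal:
  assumes "\<not> extremal G" "5 \<le> card (verts G)"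
  shows "eta G + 3 \<le> card (verts G)"
  using shape_if_eta_large[OF doubly] assms unfolding extremal_def by fastforce

lemma compl_eta_le_if_not_extremal:
  assumes "\<not> extremal (graph_compl G)" "5 \<le> card (verts G)"
  shows "eta (graph_compl G) + 3 \<le> card (verts G)"
proof -
  interpret C: doubly_connected_graph "graph_compl G"
    by (rule doubly_connected_graph_compl) unfold_locales
  show ?thesis using C.eta_le_if_not_extremal assms by simp
qed

lemma iso_listed_if_eta_sum_4:
  assumes sum: "eta G + eta (graph_compl G) = 4" and n: "5 \<le> card (verts G)"
  shows "\<exists>H \<in> {path_5, cycle_5, bull, house, graph_E, graph_F}. G \<simeq> H"
proof (cases "card (verts G) = 5")
  case True
  \<comment> \<open>At order 5 an extremal graph or complement would give the sum 5, so the four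
    extremal graphs in the order 5 list drop out.\<close>
  have "\<not> (extremal G \<or> extremal (graph_compl G))"
    using eta_sum_if_extremal eta_sum_if_compl_extremal sum True by auto
  then have neg: "\<not> G \<simeq> double_star r s" "\<not> G \<simeq> graph_compl (double_star r s)"
    if "r \<ge> 1" "s \<ge> 1" for r s
    using that unfolding extremal_or_compl_iff_iso[OF simple] by blast+
  have neg': "\<not> G \<simeq> extended_star r s" "\<not> G \<simeq> graph_compl (extended_star r s)"
    if "2 \<le> s" "s \<le> r - 1" for r s
    using that \<open>\<not> (extremal G \<or> extremal (graph_compl G))\<close>
    unfolding extremal_or_compl_iff_iso[OF simple] by blast+
  show ?thesis
    using iso_listed_if_order_5[OF True] neg[of 2 1] neg'[of 2 3] by auto
next
  case False
  then have "6 \<le> card (verts G)" using n by simp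
  moreover have "2 \<le> eta G" "2 \<le> eta (graph_compl G)" using eta_ge_2 compl.eta_ge_2 n by simp_all
  ultimately have "G \<simeq> graph_E \<or> G \<simeq> graph_F" using iso_E_or_F_if_eta_2 sum by simp
  then show ?thesis by blast
qed

end

theorem theorem4:
  fixes G :: "'a ugraph" and n :: nat
  assumes "simple_graph G"
    and "doubly_connected G"
    and "card (verts G) = n"
    and "n \<ge> 5"
  shows "(4 \<le> eta G + eta (graph_compl G) \<and> eta G + eta (graph_compl G) \<le> 2 * n - 5) \<and>
    (eta G + eta (graph_compl G) = 4 \<longleftrightarrow>
       (\<exists>H \<in> {path_5, cycle_5, bull, house, graph_E, graph_F}. G \<simeq> H)) \<and>
    (eta G + eta (graph_compl G) = 2 * n - 5 \<longleftrightarrow>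
       (\<exists>r s. r \<ge> 1 \<and> s \<ge> 1 \<and>
          (G \<simeq> double_star r s \<or> G \<simeq> graph_compl (double_star r s))) \<or>
       (\<exists>r s. 2 \<le> s \<and> s \<le> r - 1 \<and>
          (G \<simeq> extended_star r s \<or> G \<simeq> graph_compl (extended_star r s))))"
proof -
  interpret doubly_connected_graph G using assms(1,2) by unfold_locales
  have n: "5 \<le> card (verts G)" using assms(3,4) by simp
  have ge: "2 \<le> eta G" "2 \<le> eta (graph_compl G)" using eta_ge_2 compl.eta_ge_2 n by simp_all
  have four: "eta G + eta (graph_compl G) = 4 \<longleftrightarrow>
      (\<exists>H \<in> {path_5, cycle_5, bull, house, graph_E, graph_F}. G \<simeq> H)"
    using iso_listed_if_eta_sum_4 eta_le_2_if_iso_listed ge n by fastforce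
  have ext: "eta G + eta (graph_compl G) = 2 * n - 5" if "extremal G \<or> extremal (graph_compl G)"
    using eta_sum_if_extremal eta_sum_if_compl_extremal that n assms(3) by blast
  \<comment> \<open>Both values are at most \<open>n - 3\<close>, so the sum is at most
    \<open>2 * n - 6\<close>.\<close>
  have other: "eta G + eta (graph_compl G) < 2 * n - 5"
    if "\<not> (extremal G \<or> extremal (graph_compl G))"
    using eta_le_if_not_extremal compl_eta_le_if_not_extremal that n assms(3) by fastforce
  have "eta G + eta (graph_compl G) \<le> 2 * n - 5" using ext other by fastforce
  moreover have "eta G + eta (graph_compl G) = 2 * n - 5 \<longleftrightarrow> extremal G \<or> extremal (graph_compl G)"
    using ext other by fastforce
  moreover have "4 \<le> eta G + eta (graph_compl G)" using ge by linarith
  ultimately show ?thesis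
    using four unfolding extremal_or_compl_iff_iso[OF assms(1)] by (intro conjI)
qed

end
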